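(* Let $n,d,r$ be positive integers. There exists an open and dense semi-algebraic set $\mathcal{U}_5$ in $\mathbb{R}^{r\times n(d)}$ such that for any $u\in\mathcal{U}_5$ and any $f\in\mathcal{C}(F(x,u))$, $f$ is "good at infinity" in the sense that there exist constants $c>0$ and $R>0$ such that $\mathfrak{m}^{\circ}_f(x)\ge c$ for any $x\in\mathbb{R}^n$ with $\|x\|\ge R$.
   Context: Let $n(d):=\#\{\alpha\in\mathbb{N}^n : |\alpha|\le d\}$, where $|\alpha|=\alpha_1+\cdots+\alpha_n$. For $u=(u^{(1)},\ldots,u^{(r)})\in\mathbb{R}^{r\times n(d)}$ with $u^{(i)}=(u^{(i)}_\alpha)_{|\alpha|\le d}\in\mathbb{R}^{n(d)}$, put $f_i(x,u^{(i)})=\sum_{|\alpha|\le d}u^{(i)}_\alpha x^\alpha$, a polynomial in $x\in\mathbb{R}^n$ of degree at most $d$, and $F(x,u)=(f_1(x,u^{(1)}),\ldots,f_r(x,u^{(r)}))$. $\mathcal{C}(F(x,u))$ is the set of all continuous selections of these polynomials, i.e. all continuous functions $f\colon\mathbb{R}^n\to\mathbb{R}$ with $f(x)\in\{f_1(x,u^{(1)}),\ldots,f_r(x,u^{(r)})\}$ for every $x\in\mathbb{R}^n$; such functions are locally Lipschitz. For a locally Lipschitz $f$, $f^0(\bar x;v)=\limsup_{x\to\bar x,\,t\downarrow0}\frac{f(x+tv)-f(x)}{t}$ and the Clarke subdifferential is $\partial^\circ f(\bar x)=\{\zeta\in\mathbb{R}^n : \langle\zeta,v\rangle\le f^0(\bar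 x;v)\ \forall v\in\mathbb{R}^n\}$. The non-smooth slope of $f$ at $x$ is $\mathfrak{m}^\circ_f(x)=\inf\{\|\zeta\| : \zeta\in\partial^\circ f(x)\}$ (Euclidean norm). *)

theory Defs
  imports "HOL-Analysis.Analysis"
begin

text \<open>
  A finite-dimensional space \<open>\<real>\<^sup>I\<close> is the topological space \<^term>\<open>powertop_real I\<close>, whose points are
  the extensional functions \<^term>\<open>I \<rightarrow>\<^sub>E (UNIV :: real set)\<close>.
\<close>

inductive polynomial_in :: "'i set \<Rightarrow> (('i \<Rightarrow> real) \<Rightarrow> real) \<Rightarrow> bool" for I where
  const: "polynomial_in I (\<lambda>x. c)"
| coord: "i \<in> I \<Longrightarrow> polynomial_in I (\<lambda>x. x i)"
| add: "polynomial_in I p \<Longrightarrow> polynomial_in I q \<Longrightarrow> polynomial_in I (\<lambda>x. p x + q x)"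
| mult: "polynomial_in I p \<Longrightarrow> polynomial_in I q \<Longrightarrow> polynomial_in I (\<lambda>x. p x * q x)"

text \<open>
  A finite union of sets, each given by finitely many polynomial equations and strict
  inequalities; \<open>D\<close> lists the pairs (equations, inequalities).
\<close>

definition semialgebraic_in :: "'i set \<Rightarrow> ('i \<Rightarrow> real) set \<Rightarrow> bool" where
  "semialgebraic_in I S \<longleftrightarrow>
    (\<exists>D. finite D \<and>
      (\<forall>(E, G)\<in>D. finite E \<and> finite G \<and> (\<forall>p\<in>E \<union> G. polynomial_in I p)) \<and>
      S = (\<Union>(E, G)\<in>D. {x \<in> I \<rightarrow>\<^sub>E UNIV. (\<forall>p\<in>E. p x = 0) \<and> (\<forall>q\<in>G. 0 < q x)}))"

definition multi_indices :: "nat \<Rightarrow> ('n::finite \<Rightarrow> nat) set" where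
  "multi_indices d = {\<alpha>. (\<Sum>j\<in>UNIV. \<alpha> j) \<le> d}"

lemma finite_multi_indices: "finite (multi_indices d :: ('n::finite \<Rightarrow> nat) set)"
proof (rule finite_subset)
  show "multi_indices d \<subseteq> (UNIV :: 'n set) \<rightarrow>\<^sub>E {..d}"
  proof
    fix \<alpha> :: "'n \<Rightarrow> nat"
    assume "\<alpha> \<in> multi_indices d"
    then have "\<alpha> j \<le> d" for j
      using member_le_sum[of j UNIV \<alpha>] by (simp add: multi_indices_def)
    then show "\<alpha> \<in> UNIV \<rightarrow>\<^sub>E {..d}" by auto
  qed
qed (simp add: finite_PiE)

text \<open>\<open>\<real>\<^bsup>r \<times> n(d)\<^esup>\<close> is \<open>\<real>\<^sup>I\<close> for the following index set \<open>I\<close>.\<close>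

definition coeff_indices :: "nat \<Rightarrow> nat \<Rightarrow> (nat \<times> ('n::finite \<Rightarrow> nat)) set" where
  "coeff_indices r d = {1..r} \<times> multi_indices d"

definition family_poly ::
    "nat \<Rightarrow> (nat \<times> ('n::finite \<Rightarrow> nat) \<Rightarrow> real) \<Rightarrow> nat \<Rightarrow> real ^ 'n \<Rightarrow> real" where
  "family_poly d u i x = (\<Sum>\<alpha>\<in>multi_indices d. u (i, \<alpha>) * (\<Prod>j\<in>UNIV. (x $ j) ^ \<alpha> j))"

definition continuous_selections ::
    "nat \<Rightarrow> nat \<Rightarrow> (nat \<times> ('n::finite \<Rightarrow> nat) \<Rightarrow> real) \<Rightarrow> (real ^ 'n \<Rightarrow> real) set" where
  "continuous_selections r d u =
    {f. continuous_on UNIV f \<and> (\<forall>x. f x \<in> (\<lambda>i. family_poly d u i x) ` {1..r})}"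

text \<open>
  In the limes superior the base point \<open>y\<close> may equal \<open>x\<close>, hence \<^term>\<open>nhds x\<close> rather than \<open>at x\<close>.
  It is taken in the extended reals; for locally Lipschitz \<open>f\<close> it is finite.
\<close>

definition clarke_derivative :: "('a::euclidean_space \<Rightarrow> real) \<Rightarrow> 'a \<Rightarrow> 'a \<Rightarrow> ereal" where
  "clarke_derivative f x v =
    Limsup (nhds x \<times>\<^sub>F at_right 0) (\<lambda>(y, t). ereal ((f (y + t *\<^sub>R v) - f y) / t))"

definition clarke_subdifferential :: "('a::euclidean_space \<Rightarrow> real) \<Rightarrow> 'a \<Rightarrow> 'a set" where
  "clarke_subdifferential f x = {\<zeta>. \<forall>v. ereal (\<zeta> \<bullet> v) \<le> clarke_derivative f x v}"

text \<open>
  The infimum is taken in the extended reals; for locally Lipschitz \<open>f\<close> the subdifferential is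
  nonempty, so the value is a nonnegative real.
\<close>

definition nonsmooth_slope :: "('a::euclidean_space \<Rightarrow> real) \<Rightarrow> 'a \<Rightarrow> ereal" where
  "nonsmooth_slope f x = (INF \<zeta>\<in>clarke_subdifferential f x. ereal (norm \<zeta>))"

definition good_at_infinity :: "('a::euclidean_space \<Rightarrow> real) \<Rightarrow> bool" where
  "good_at_infinity f \<longleftrightarrow>
    (\<exists>c>0. \<exists>R>0. \<forall>x. R \<le> norm x \<longrightarrow> ereal c \<le> nonsmooth_slope f x)"

end

theory Submission
  imports Defs
begin

text \<open>
  Let \<open>p\<^sub>i\<close> be the part of degree exactly \<open>d\<close> of \<open>f\<^sub>i\<close>. If a subgradient of a continuous selection is
  small at a far point \<open>x\<close>, then in the limit direction \<open>y\<close> some convex combination of the gradients of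
  the active \<open>p\<^sub>i\<close> vanishes; since the active \<open>f\<^sub>i\<close> agree at \<open>x\<close>, Euler's identity then forces
  \<open>p\<^sub>i(y) = 0\<close> for all of them. Such degenerate systems form finitely many families, each
  parametrised polynomially with one parameter fewer than the number of coefficients. As more
  polynomials than variables are algebraically dependent, a nonzero polynomial \<open>Q\<close> in the coefficients
  vanishes on all of them, and \<open>{u. Q u \<noteq> 0}\<close> is the required set. This avoids both quantifier
  elimination and dimension theory.
\<close>

section \<open>Polynomials vanishing on parametrised sets\<close>

text \<open>A vanishing combination of gradients is not rare by itself. With J the set of pieces
  involved, it gives n equations for n - 1 direction parameters and |J| - 1 multipliers, which is
  too few equations once |J| is at least 2. The |J| further conditions p_i(y) = 0 make it rare,
  although by Euler's identity they also make one of the n gradient equations redundant: |J| + n - 1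
  equations remain for |J| + n - 2 unknowns, an excess of one. Convexity matters in the analytic
  half, where separating the gradients from 0 gives a direction in which all active pieces increase.
  The counting half keeps only a linear relation with a nonzero coefficient.\<close>

lemma underdetermined_linear_system:
  fixes c :: "'a \<Rightarrow> 'b \<Rightarrow> real"
  assumes "finite T" "finite S" "card T < card S"
  shows "\<exists>a. (\<exists>s\<in>S. a s \<noteq> 0) \<and> (\<forall>t\<in>T. (\<Sum>s\<in>S. a s * c s t) = 0)"
  using assms
proof (induction T arbitrary: S c rule: finite_induct)
  case empty
  then obtain s where "s \<in> S" by fastforce
  then show ?case by (intro exI[of _ "\<lambda>_. 1"]) auto
next
  case (insert t T)
  show ?case
  proof (cases "\<forall>s\<in>S. c s t = 0")
    case True
    moreover have "card T < card S" using insert.prems insert.hyps by simp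
    then obtain a where "\<exists>s\<in>S. a s \<noteq> 0" "\<forall>t\<in>T. (\<Sum>s\<in>S. a s * c s t) = 0"
      using insert.IH[of S c] insert.prems(1) by blast
    ultimately show ?thesis by (intro exI[of _ a]) simp
  next
    case False
    then obtain s0 where s0: "s0 \<in> S" "c s0 t \<noteq> 0" by blast
    \<comment> \<open>Solving equation \<open>t\<close> for the unknown of the pivot
      \<open>s0\<close> and substituting the result into the other equations leaves the coefficients
      \<open>c'\<close>.\<close>
    define c' where "c' = (\<lambda>s t'. c s t' - c s t / c s0 t * c s0 t')"
    have "card T < card (S - {s0})"
      using insert.prems insert.hyps s0 by simp
    then obtain a where a: "\<exists>s\<in>S - {s0}. a s \<noteq> 0" "\<And>t'. t' \<in> T \<Longrightarrow> (\<Sum>s\<in>S - {s0}. a s * c' s t') = 0"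
      using insert.IH[of "S - {s0}" c'] insert.prems by auto
    define b where "b = a(s0 := - (\<Sum>s\<in>S - {s0}. a s * c s t) / c s0 t)"
    have sum_b: "(\<Sum>s\<in>S. b s * c s t') = b s0 * c s0 t' + (\<Sum>s\<in>S - {s0}. a s * c s t')" for t'
      using s0 insert.prems(1) by (subst sum.remove[of S s0]) (auto simp: b_def intro!: sum.cong)
    have "(\<Sum>s\<in>S. b s * c s t) = 0"
      unfolding sum_b using s0 by (simp add: b_def)
    moreover have "(\<Sum>s\<in>S. b s * c s t') = 0" if "t' \<in> T" for t'
    proof -
      have "0 = (\<Sum>s\<in>S - {s0}. a s * c s t' - (a s * c s t) * (c s0 t' / c s0 t))"
        using a(2)[OF that] by (simp add: c'_def algebra_simps)
      also have "\<dots> = (\<Sum>s\<in>S - {s0}. a s * c s t') - (\<Sum>s\<in>S - {s0}. a s * c s t) * (c s0 t' / c s0 t)"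
        by (simp only: sum_subtractf sum_distrib_right)
      finally show ?thesis
        unfolding sum_b by (simp add: b_def)
    qed
    moreover have "\<exists>s\<in>S. b s \<noteq> 0" using a(1) by (auto simp: b_def)
    ultimately show ?thesis by blast
  qed
qed

text \<open>Zeros on a grid are controlled by the degree in each variable separately, and this
  notion needs no coefficient representation of multivariate polynomials.\<close>

definition separate_degree_le :: "nat \<Rightarrow> (('i \<Rightarrow> real) \<Rightarrow> real) \<Rightarrow> bool" where
  "separate_degree_le k f \<longleftrightarrow>
    (\<forall>x i. \<exists>p. degree p \<le> k \<and> (\<forall>t. f (x(i := t)) = poly p t))"

lemma separate_degree_le_const: "separate_degree_le k (\<lambda>x. c)"
  unfolding separate_degree_le_def by (intro allI exI[of _ "[:c:]"]) auto

lemma separate_degree_le_add: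
  assumes "separate_degree_le k f" "separate_degree_le k g"
  shows "separate_degree_le k (\<lambda>x. f x + g x)"
  unfolding separate_degree_le_def
proof (intro allI)
  fix x i
  obtain p q where "degree p \<le> k" "degree q \<le> k"
    "\<And>t. f (x(i := t)) = poly p t" "\<And>t. g (x(i := t)) = poly q t"
    using assms unfolding separate_degree_le_def by metis
  then show "\<exists>p. degree p \<le> k \<and> (\<forall>t. f (x(i := t)) + g (x(i := t)) = poly p t)"
    by (intro exI[of _ "p + q"]) (simp add: degree_add_le)
qed

lemma separate_degree_le_mult:
  assumes "separate_degree_le k f" "separate_degree_le l g"
  shows "separate_degree_le (k + l) (\<lambda>x. f x * g x)"
  unfolding separate_degree_le_def
proof (intro allI)
  fix x i
  obtain p q where "degree p \<le> k" "degree q \<le> l"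
    "\<And>t. f (x(i := t)) = poly p t" "\<And>t. g (x(i := t)) = poly q t"
    using assms unfolding separate_degree_le_def by metis
  then show "\<exists>p. degree p \<le> k + l \<and> (\<forall>t. f (x(i := t)) * g (x(i := t)) = poly p t)"
    by (intro exI[of _ "p * q"]) (auto intro: order_trans[OF degree_mult_le])
qed

lemma separate_degree_le_sum:
  "(\<And>s. s \<in> S \<Longrightarrow> separate_degree_le k (f s)) \<Longrightarrow> separate_degree_le k (\<lambda>x. \<Sum>s\<in>S. f s x)"
  by (induction S rule: infinite_finite_induct)
    (auto intro: separate_degree_le_const separate_degree_le_add)

lemma separate_degree_le_prod:
  "finite S \<Longrightarrow> (\<And>s. s \<in> S \<Longrightarrow> separate_degree_le k (f s)) \<Longrightarrow>
    separate_degree_le (card S * k) (\<lambda>x. \<Prod>s\<in>S. f s x)"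
  by (induction S rule: finite_induct)
    (auto intro: separate_degree_le_const separate_degree_le_mult)

lemma separate_degree_le_mono:
  "separate_degree_le k f \<Longrightarrow> k \<le> l \<Longrightarrow> separate_degree_le l f"
  unfolding separate_degree_le_def by (meson order_trans)

lemma polynomial_in_separate_degree:
  "polynomial_in I f \<Longrightarrow> \<exists>k. separate_degree_le k f"
proof (induction rule: polynomial_in.induct)
  case (const c)
  then show ?case using separate_degree_le_const by blast
next
  case (coord i)
  have "separate_degree_le 1 (\<lambda>x. x i)"
    unfolding separate_degree_le_def
  proof (intro allI)
    fix x :: "'a \<Rightarrow> real" and j
    show "\<exists>p. degree p \<le> 1 \<and> (\<forall>t. (x(j := t)) i = poly p t)"
      by (intro exI[of _ "if i = j then [:0, 1:] else [:x i:]"]) auto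
  qed
  then show ?case by blast
next
  case (add p q)
  then obtain k l where "separate_degree_le k p" "separate_degree_le l q" by blast
  then have "separate_degree_le (max k l) p" "separate_degree_le (max k l) q"
    by (auto elim: separate_degree_le_mono)
  then show ?case using separate_degree_le_add by blast
next
  case (mult p q)
  then show ?case using separate_degree_le_mult by blast
qed

text \<open>In one variable \<open>f\<close> has degree at most \<open>k\<close> but vanishes at the
  \<open>k + 1\<close> nodes \<open>0, ..., k\<close>. The point \<open>z\<close> fixes the
  coordinates outside \<open>I\<close>; it is arbitrary so that the induction can freeze coordinate
  \<open>j\<close> at a node.\<close>

lemma zero_on_grid_imp_zero:
  fixes f :: "('i \<Rightarrow> real) \<Rightarrow> real"
  assumes "separate_degree_le k f" "finite I"
    and grid: "\<And>x. (\<forall>i\<in>I. x i \<in> real ` {..k}) \<Longrightarrow> (\<forall>i. i \<notin> I \<longrightarrow> x i = z i) \<Longrightarrow> f x = 0"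
    and "\<forall>i. i \<notin> I \<longrightarrow> x i = z i"
  shows "f x = 0"
  using assms(2-4)
proof (induction I arbitrary: x z rule: finite_induct)
  case empty
  then show ?case by blast
next
  case (insert j I)
  obtain p where p: "degree p \<le> k" "\<And>t. f (x(j := t)) = poly p t"
    using assms(1) unfolding separate_degree_le_def by metis
  have "poly p (real m) = 0" if "m \<le> k" for m
  proof -
    have "f (x(j := real m)) = 0"
    proof (rule insert.IH[where z = "x(j := real m)"])
      fix y
      assume y: "\<forall>i\<in>I. y i \<in> real ` {..k}" "\<forall>i. i \<notin> I \<longrightarrow> y i = (x(j := real m)) i"
      show "f y = 0"
        using y insert.prems(2) insert.hyps(2) that by (intro insert.prems(1)) auto
    qed simp
    then show ?thesis using p(2) by simp
  qed
  then have sub: "real ` {..k} \<subseteq> {t. poly p t = 0}" by auto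
  have "p = 0"
  proof (rule ccontr)
    assume "p \<noteq> 0"
    then have "card (real ` {..k}) \<le> card {t. poly p t = 0}"
      using sub by (intro card_mono poly_roots_finite) auto
    also have "\<dots> \<le> degree p" using \<open>p \<noteq> 0\<close> by (rule card_poly_roots_bound)
    finally show False using p(1) by (simp add: card_image)
  qed
  then show ?case using p(2)[of "x j"] by simp
qed

lemma polynomial_in_sum:
  "(\<And>s. s \<in> S \<Longrightarrow> polynomial_in I (f s)) \<Longrightarrow> polynomial_in I (\<lambda>x. \<Sum>s\<in>S. f s x)"
  by (induction S rule: infinite_finite_induct) (auto intro: polynomial_in.intros)

lemma polynomial_in_prod:
  "(\<And>s. s \<in> S \<Longrightarrow> polynomial_in I (f s)) \<Longrightarrow> polynomial_in I (\<lambda>x. \<Prod>s\<in>S. f s x)"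
  by (induction S rule: infinite_finite_induct) (auto intro: polynomial_in.intros)

lemma polynomial_in_power: "polynomial_in I f \<Longrightarrow> polynomial_in I (\<lambda>x. f x ^ k)"
  by (induction k) (auto intro: polynomial_in.intros)

lemma polynomial_in_minus: "polynomial_in I f \<Longrightarrow> polynomial_in I (\<lambda>x. - f x)"
  using polynomial_in.mult[OF polynomial_in.const[of I "-1"], of f] by simp

lemma polynomial_in_diff:
  "polynomial_in I f \<Longrightarrow> polynomial_in I g \<Longrightarrow> polynomial_in I (\<lambda>x. f x - g x)"
  using polynomial_in.add[OF _ polynomial_in_minus, of I f g] by simp

lemma polynomial_in_cong:
  "polynomial_in I f \<Longrightarrow> (\<And>i. i \<in> I \<Longrightarrow> x i = y i) \<Longrightarrow> f x = f y"
  by (induction rule: polynomial_in.induct) auto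

text \<open>
  Algebraic dependence by counting: products of Lagrange polynomials span a space of dimension
  \<open>(D + 1)\<^sup>N\<close>, whereas their compositions with \<open>\<phi>\<close> are determined by their values on a grid of
  size \<open>O(D)\<^sup>M\<close> with \<open>M < N\<close>.
\<close>

lemma polynomial_vanishing_on_image:
  fixes \<phi> :: "'i \<Rightarrow> ('j \<Rightarrow> real) \<Rightarrow> real"
  assumes fin: "finite I" "finite J" and card: "card J < card I"
    and poly: "\<And>i. i \<in> I \<Longrightarrow> polynomial_in J (\<phi> i)"
  shows "\<exists>P. polynomial_in I P \<and> (\<exists>u. P u \<noteq> 0) \<and> (\<forall>w. P (\<lambda>i. \<phi> i w) = 0)"
proof -
  obtain k where k: "\<And>i. i \<in> I \<Longrightarrow> separate_degree_le (k i) (\<phi> i)"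
    using polynomial_in_separate_degree[OF poly] by metis
  define K where "K = (\<Sum>i\<in>I. k i)"
  have K: "separate_degree_le K (\<phi> i)" if "i \<in> I" for i
    using separate_degree_le_mono[OF k[OF that]] member_le_sum[of i I k] that fin
    by (simp add: K_def)
  define N where "N = card I"
  \<comment> \<open>The test grid has \<open>(N * (D * K) + 1) ^ card J\<close> points, at most
    \<open>((N * K + 1) * (D + 1)) ^ card J\<close>. To stay below \<open>(D + 1) ^ N\<close>, it
    suffices that \<open>(N * K + 1) ^ card J\<close> is less than \<open>D + 1\<close>.\<close>
  define D where "D = (N * K + 1) ^ card J"
  \<comment> \<open>Unnormalised Lagrange polynomials: among the grid points in \<open>?S\<close>,
    \<open>L g\<close> is nonzero only at \<open>g\<close>, so evaluation at \<open>g\<close>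
    isolates the coefficient \<open>a g\<close>.\<close>
  define L where "L = (\<lambda>g u. \<Prod>i\<in>I. \<Prod>m\<in>{..D} - {g i}. u i - real m)"
  let ?S = "I \<rightarrow>\<^sub>E {..D}" and ?T = "J \<rightarrow>\<^sub>E {..N * (D * K)}"
  have "card ?T = (N * (D * K) + 1) ^ card J"
    using fin by (simp add: card_PiE)
  also have "\<dots> \<le> ((N * K + 1) * (D + 1)) ^ card J"
    by (intro power_mono) (auto simp: algebra_simps)
  also have "\<dots> = D * (D + 1) ^ card J"
    by (simp only: power_mult_distrib flip: D_def)
  also have "\<dots> < (D + 1) * (D + 1) ^ card J" by simp
  also have "\<dots> \<le> (D + 1) ^ N"
    using card unfolding N_def power_Suc[symmetric] by (intro power_increasing) auto
  also have "\<dots> = card ?S"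
    using fin by (simp add: card_PiE N_def)
  finally have "card ?T < card ?S" .
  moreover have "finite ?S" "finite ?T" using fin by (auto intro: finite_PiE)
  ultimately obtain a where a: "\<exists>g\<in>?S. a g \<noteq> 0"
    "\<And>h. h \<in> ?T \<Longrightarrow> (\<Sum>g\<in>?S. a g * L g (\<lambda>i. \<phi> i (\<lambda>j. real (h j)))) = 0"
    using underdetermined_linear_system[of ?T ?S "\<lambda>g h. L g (\<lambda>i. \<phi> i (\<lambda>j. real (h j)))"] by blast
  define P where "P = (\<lambda>u. \<Sum>g\<in>?S. a g * L g u)"
  have "polynomial_in I P"
    unfolding P_def L_def
    by (intro polynomial_in_sum polynomial_in_prod polynomial_in_diff polynomial_in.intros)
  moreover have "\<exists>u. P u \<noteq> 0"
  proof -
    obtain g where g: "g \<in> ?S" "a g \<noteq> 0" using a(1) by blast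
    have "L g' (\<lambda>i. real (g i)) = 0" if g': "g' \<in> ?S" "g' \<noteq> g" for g'
    proof -
      have "\<exists>i\<in>I. g i \<noteq> g' i"
        using PiE_ext[OF g'(1) g(1)] g'(2) by metis
      then obtain i where "i \<in> I" "g i \<noteq> g' i" by blast
      moreover from this have "(\<Prod>m\<in>{..D} - {g' i}. real (g i) - real m) = 0"
        using g(1) by (intro prod_zero) auto
      ultimately show ?thesis
        unfolding L_def using fin by (intro prod_zero) auto
    qed
    then have "P (\<lambda>i. real (g i)) = (\<Sum>g'\<in>{g}. a g' * L g' (\<lambda>i. real (g i)))"
      unfolding P_def using g(1) \<open>finite ?S\<close> by (intro sum.mono_neutral_right) auto
    also have "\<dots> \<noteq> 0" using g(2) fin by (auto simp: L_def)
    finally show ?thesis by blast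
  qed
  moreover have "P (\<lambda>i. \<phi> i w) = 0" for w
  proof (rule zero_on_grid_imp_zero[where f = "\<lambda>w. P (\<lambda>i. \<phi> i w)" and I = J and z = w])
    have "separate_degree_le K (\<lambda>w. \<phi> i w - real m)" if "i \<in> I" for i m
      using separate_degree_le_add[OF K[OF that] separate_degree_le_const[of _ "- real m"]] by simp
    then have "separate_degree_le (card ({..D} - {g i}) * K) (\<lambda>w. \<Prod>m\<in>{..D} - {g i}. \<phi> i w - real m)"
      if "i \<in> I" for i and g :: "'i \<Rightarrow> nat"
      using that by (intro separate_degree_le_prod) auto
    \<comment> \<open>Omitting \<open>g i\<close> from the \<open>D + 1\<close> nodes leaves exactly
      \<open>D\<close> factors.\<close>
    moreover have "card ({..D} - {g i}) = D" if "i \<in> I" "g \<in> ?S" for i g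
      using PiE_mem[OF that(2,1)] by simp
    ultimately have "separate_degree_le (D * K) (\<lambda>w. \<Prod>m\<in>{..D} - {g i}. \<phi> i w - real m)"
      if "i \<in> I" "g \<in> ?S" for i g
      using that by metis
    then have "separate_degree_le (N * (D * K)) (\<lambda>w. L g (\<lambda>i. \<phi> i w))" if "g \<in> ?S" for g
      unfolding L_def N_def using that fin by (intro separate_degree_le_prod) auto
    then have "separate_degree_le (0 + N * (D * K)) (\<lambda>w. P (\<lambda>i. \<phi> i w))"
      unfolding P_def
      by (intro separate_degree_le_sum separate_degree_le_mult separate_degree_le_const)
    then show "separate_degree_le (N * (D * K)) (\<lambda>w. P (\<lambda>i. \<phi> i w))" by simp
    fix x assume x: "\<forall>j\<in>J. x j \<in> real ` {..N * (D * K)}"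
    define h where "h = (\<lambda>j\<in>J. nat \<lfloor>x j\<rfloor>)"
    have h: "h \<in> ?T" "\<And>j. j \<in> J \<Longrightarrow> real (h j) = x j"
      using x by (auto simp: h_def)
    have "L g (\<lambda>i. \<phi> i x) = L g (\<lambda>i. \<phi> i (\<lambda>j. real (h j)))" for g
      unfolding L_def using polynomial_in_cong[OF poly, of _ x "\<lambda>j. real (h j)"] h(2)
      by (intro prod.cong) auto
    then show "P (\<lambda>i. \<phi> i x) = 0"
      using a(2)[OF h(1)] by (simp add: P_def)
  qed (use fin in auto)
  ultimately show ?thesis by blast
qed

section \<open>Sets where a polynomial does not vanish\<close>

lemma polynomial_in_on_line:
  "polynomial_in I f \<Longrightarrow> \<exists>p. \<forall>t. f (\<lambda>i. a i + t * b i) = poly p t"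
proof (induction rule: polynomial_in.induct)
  case (const c)
  show ?case by (intro exI[of _ "[:c:]"]) simp
next
  case (coord i)
  show ?case by (intro exI[of _ "[:a i, b i:]"]) simp
next
  case (add p q)
  then obtain P Q where "\<And>t. p (\<lambda>i. a i + t * b i) = poly P t" "\<And>t. q (\<lambda>i. a i + t * b i) = poly Q t"
    by blast
  then show ?case by (intro exI[of _ "P + Q"]) simp
next
  case (mult p q)
  then obtain P Q where "\<And>t. p (\<lambda>i. a i + t * b i) = poly P t" "\<And>t. q (\<lambda>i. a i + t * b i) = poly Q t"
    by blast
  then show ?case by (intro exI[of _ "P * Q"]) simp
qed

lemma polynomial_in_finite_zeros_on_line:
  assumes "polynomial_in I f" "f (\<lambda>i. a i + s * b i) \<noteq> 0"
  shows "finite {t. f (\<lambda>i. a i + t * b i) = 0}"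
proof -
  obtain p where p: "\<And>t. f (\<lambda>i. a i + t * b i) = poly p t"
    using polynomial_in_on_line[OF assms(1)] by blast
  then have "p \<noteq> 0" using assms(2) by auto
  then show ?thesis using p poly_roots_finite by simp
qed

text \<open>On the line joining a nonzero of one factor to a nonzero of the remaining product, both
  have finitely many zeros, so some point avoids them all.\<close>

lemma polynomial_in_prod_nonzero:
  assumes "finite S" "\<And>s. s \<in> S \<Longrightarrow> polynomial_in I (f s)" "\<And>s. s \<in> S \<Longrightarrow> \<exists>u. f s u \<noteq> 0"
  shows "\<exists>u. (\<Prod>s\<in>S. f s u) \<noteq> 0"
  using assms
proof (induction S rule: finite_induct)
  case (insert s S)
  have "\<exists>u. (\<Prod>s\<in>S. f s u) \<noteq> 0" "\<exists>v. f s v \<noteq> 0"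
    using insert.IH insert.prems by auto
  then obtain u v where uv: "(\<Prod>s\<in>S. f s u) \<noteq> 0" "f s v \<noteq> 0" by blast
  let ?l = "\<lambda>t i. u i + t * (v i - u i)"
  have "finite {t. f s (?l t) = 0}"
    using uv(2) insert.prems by (intro polynomial_in_finite_zeros_on_line[where s = 1]) auto
  moreover have "finite {t. (\<Prod>s\<in>S. f s (?l t)) = 0}"
    using uv(1) insert.prems
    by (intro polynomial_in_finite_zeros_on_line[where s = 0 and f = "\<lambda>u. \<Prod>s\<in>S. f s u"]
          polynomial_in_prod) auto
  ultimately have "finite ({t. f s (?l t) = 0} \<union> {t. (\<Prod>s\<in>S. f s (?l t)) = 0})" by blast
  then obtain t where "t \<notin> {t. f s (?l t) = 0} \<union> {t. (\<Prod>s\<in>S. f s (?l t)) = 0}"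
    using ex_new_if_finite infinite_UNIV_char_0 by blast
  then show ?case using insert.hyps by auto
qed simp

lemma polynomial_in_continuous_map:
  "polynomial_in I f \<Longrightarrow> continuous_map (powertop_real I) euclideanreal f"
  by (induction rule: polynomial_in.induct)
    (auto intro: continuous_map_product_projection continuous_map_add continuous_map_real_mult)

lemma openin_polynomial_nonzero:
  assumes "polynomial_in I f"
  shows "openin (powertop_real I) {u \<in> I \<rightarrow>\<^sub>E UNIV. f u \<noteq> 0}"
  using openin_continuous_map_preimage[OF polynomial_in_continuous_map[OF assms], of "- {0}"]
  by (simp add: open_Compl)

text \<open>On the line from \<open>u\<close> to \<open>w\<close> the polynomial has finitely many
  zeros, so points arbitrarily close to \<open>u\<close> avoid them.\<close>

lemma dense_polynomial_nonzero:
  assumes "polynomial_in I f" "f w \<noteq> 0"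
  shows "powertop_real I closure_of {u \<in> I \<rightarrow>\<^sub>E UNIV. f u \<noteq> 0} = topspace (powertop_real I)"
proof (rule antisym[OF closure_of_subset_topspace], rule subsetI, unfold in_closure_of, safe)
  fix u T
  assume "u \<in> T" and T: "openin (powertop_real I) T"
  let ?l = "\<lambda>t i. u i + t * (w i - u i)"
  have u: "u \<in> I \<rightarrow>\<^sub>E UNIV" using openin_subset[OF T] \<open>u \<in> T\<close> by auto
  \<comment> \<open>The point \<open>w\<close> need not be extensional, so the line is cut down to
    \<open>I\<close>; \<open>f\<close> sees only these coordinates.\<close>
  have "continuous_map euclideanreal (powertop_real I) (\<lambda>t. restrict (?l t) I)"
    by (subst continuous_map_componentwise)
      (auto intro!: continuous_intros)
  from openin_continuous_map_preimage[OF this T]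
  have "open {t. restrict (?l t) I \<in> T}" by simp
  moreover have "restrict (?l 0) I = u" using u by (auto simp: PiE_iff extensional_def)
  then have "0 \<in> {t. restrict (?l t) I \<in> T}"
    using \<open>u \<in> T\<close> by (simp only: mem_Collect_eq)
  ultimately obtain e where e: "e > 0" "ball 0 e \<subseteq> {t. restrict (?l t) I \<in> T}"
    unfolding open_contains_ball by blast
  have "finite {t. f (?l t) = 0}"
    using assms by (intro polynomial_in_finite_zeros_on_line[where s = 1]) auto
  moreover have "infinite {0<..<e}" using e(1) by (simp add: infinite_Ioo)
  ultimately obtain t where t: "t \<in> {0<..<e}" "f (?l t) \<noteq> 0"
    using finite_subset[of "{0<..<e}" "{t. f (?l t) = 0}"] by blast
  have "f (restrict (?l t) I) = f (?l t)"
    by (rule polynomial_in_cong[OF assms(1)]) simp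
  moreover have "t \<in> ball 0 e" using t(1) by simp
  then have "restrict (?l t) I \<in> T" using e(2) by blast
  ultimately show "\<exists>y. y \<in> {u \<in> I \<rightarrow>\<^sub>E UNIV. f u \<noteq> 0} \<and> y \<in> T"
    using t(2) by (intro exI[of _ "restrict (?l t) I"]) auto
qed

text \<open>Squaring turns the inequation into the single strict inequality
  \<open>0 < f u ^ 2\<close>.\<close>

lemma semialgebraic_in_polynomial_nonzero:
  assumes "polynomial_in I f"
  shows "semialgebraic_in I {u \<in> I \<rightarrow>\<^sub>E UNIV. f u \<noteq> 0}"
proof -
  have "polynomial_in I (\<lambda>u. f u ^ 2)" by (rule polynomial_in_power[OF assms])
  then show ?thesis
    unfolding semialgebraic_in_def
    by (intro exI[of _ "{({}, {\<lambda>u. f u ^ 2})}"]) simp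
qed

section \<open>Subgradients of continuous selections\<close>

text \<open>
  If the selection increased, each level \<open>c\<close> between the end values would have a last crossing time,
  increasing in \<open>c\<close>; two levels whose last crossings select the same piece contradict its monotonicity.
\<close>

lemma continuous_selection_nonincreasing:
  fixes h :: "real \<Rightarrow> real" and g :: "'i \<Rightarrow> real \<Rightarrow> real"
  assumes "a \<le> b" and cont: "continuous_on {a..b} h" and "finite K"
    and sel: "\<And>s. s \<in> {a..b} \<Longrightarrow> \<exists>i\<in>K. h s = g i s"
    and mono: "\<And>i s t. i \<in> K \<Longrightarrow> a \<le> s \<Longrightarrow> s \<le> t \<Longrightarrow> t \<le> b \<Longrightarrow> g i t \<le> g i s"
  shows "h b \<le> h a"
proof (rule ccontr)
  assume "\<not> h b \<le> h a"
  then have less: "h a < h b" by simp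
  have "\<exists>s\<in>{a..b}. h s = c \<and> (\<forall>t\<in>{s<..b}. c < h t)" if c: "c \<in> {h a..h b}" for c
  proof -
    let ?A = "{s \<in> {a..b}. h s \<le> c}"
    have "closed ?A"
      by (intro continuous_on_closed_Collect_le cont continuous_on_const closed_atLeastAtMost)
    then have "compact ?A"
      by (intro compact_eq_bounded_closed[THEN iffD2] conjI bounded_subset[OF bounded_closed_interval[of a b]])
        auto
    moreover have "?A \<noteq> {}" using c \<open>a \<le> b\<close> by auto
    ultimately obtain s where s: "s \<in> ?A" "\<And>t. t \<in> ?A \<Longrightarrow> t \<le> s"
      using compact_attains_sup[of ?A] by blast
    \<comment> \<open>The intermediate value theorem gives a point of value \<open>c\<close> at or
      after \<open>s\<close>; maximality of \<open>s\<close> identifies it with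
      \<open>s\<close>.\<close>
    have "\<exists>t\<ge>s. t \<le> b \<and> h t = c"
      using s(1) c by (intro IVT' continuous_on_subset[OF cont]) auto
    then obtain t where t: "s \<le> t" "t \<le> b" "h t = c" by blast
    then have "t \<in> ?A" using s(1) by simp
    then have "t = s" using s(2)[of t] t(1) by (intro antisym)
    then have "h s = c" using t by simp
    moreover have "\<forall>t\<in>{s<..b}. c < h t"
    proof
      fix t assume "t \<in> {s<..b}"
      then show "c < h t" using s(1) s(2)[of t] by force
    qed
    ultimately show ?thesis using s(1) by blast
  qed
  then have "\<forall>c\<in>{h a..h b}. \<exists>s. s \<in> {a..b} \<and> h s = c \<and> (\<forall>t\<in>{s<..b}. c < h t)" by blast
  from bchoice[OF this] obtain \<sigma> where \<sigma>: "\<And>c. c \<in> {h a..h b} \<Longrightarrow> \<sigma> c \<in> {a..b}"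
    "\<And>c. c \<in> {h a..h b} \<Longrightarrow> h (\<sigma> c) = c"
    "\<And>c t. c \<in> {h a..h b} \<Longrightarrow> t \<in> {\<sigma> c<..b} \<Longrightarrow> c < h t"
    by blast
  have "\<forall>c\<in>{h a..h b}. \<exists>i. i \<in> K \<and> h (\<sigma> c) = g i (\<sigma> c)"
    using sel[OF \<sigma>(1)] by blast
  from bchoice[OF this] obtain \<iota> where
    \<iota>: "\<And>c. c \<in> {h a..h b} \<Longrightarrow> \<iota> c \<in> K" "\<And>c. c \<in> {h a..h b} \<Longrightarrow> h (\<sigma> c) = g (\<iota> c) (\<sigma> c)"
    by blast
  \<comment> \<open>Pigeonhole: infinitely many levels, finitely many pieces.\<close>
  have "infinite {h a..h b}" using less by (rule infinite_Icc)
  moreover have "finite (\<iota> ` {h a..h b})"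
    using \<iota>(1) by (intro finite_subset[OF _ \<open>finite K\<close>]) auto
  ultimately have "\<not> inj_on \<iota> {h a..h b}" by (metis finite_imageD)
  then have "\<exists>c c'. c \<in> {h a..h b} \<and> c' \<in> {h a..h b} \<and> c < c' \<and> \<iota> c = \<iota> c'"
    by (rule contrapos_np) (rule linorder_inj_onI', blast)
  then obtain c c' where c: "c \<in> {h a..h b}" "c' \<in> {h a..h b}" "\<iota> c = \<iota> c'" "c < c'"
    by blast
  have "\<sigma> c \<le> \<sigma> c'"
  proof (rule ccontr)
    assume "\<not> \<sigma> c \<le> \<sigma> c'"
    then have "c' < h (\<sigma> c)" using \<sigma>(1)[OF c(1)] by (intro \<sigma>(3)[OF c(2)]) auto
    then show False using \<sigma>(2)[OF c(1)] c(4) by simp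
  qed
  then have "g (\<iota> c) (\<sigma> c') \<le> g (\<iota> c) (\<sigma> c)"
    using \<sigma>(1)[OF c(1)] \<sigma>(1)[OF c(2)] \<iota>(1)[OF c(1)] by (intro mono) auto
  then have "h (\<sigma> c') \<le> h (\<sigma> c)" unfolding \<iota>(2)[OF c(1)] \<iota>(2)[OF c(2)] c(3) .
  then show False using \<sigma>(2)[OF c(1)] \<sigma>(2)[OF c(2)] c(4) by simp
qed

text \<open>Near \<open>x\<close> only pieces active at \<open>x\<close> can be selected, and by
  continuity their slopes along \<open>v\<close> stay below \<open>M\<close>. On short segments,
  \<open>f\<close> minus the linear function of slope \<open>M\<close> is then a continuous
  selection of nonincreasing functions.\<close>

lemma clarke_derivative_le_active:
  fixes f :: "'a::euclidean_space \<Rightarrow> real" and g :: "'i \<Rightarrow> 'a \<Rightarrow> real" and D :: "'i \<Rightarrow> 'a \<Rightarrow> 'a"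
  assumes "finite K" and cont: "continuous_on UNIV f"
    and sel: "\<And>y. \<exists>i\<in>K. f y = g i y"
    and deriv: "\<And>i y t. i \<in> K \<Longrightarrow>
      ((\<lambda>t. g i (y + t *\<^sub>R v)) has_field_derivative D i (y + t *\<^sub>R v) \<bullet> v) (at t)"
    and contg: "\<And>i. i \<in> K \<Longrightarrow> continuous_on UNIV (g i)"
    and contD: "\<And>i. i \<in> K \<Longrightarrow> continuous_on UNIV (D i)"
    and bound: "\<And>i. i \<in> K \<Longrightarrow> g i x = f x \<Longrightarrow> D i x \<bullet> v < M"
  shows "clarke_derivative f x v \<le> ereal M"
proof -
  define A where "A = {i \<in> K. g i x = f x}"
  have lim: "(f \<longlongrightarrow> f x) (nhds x)" "\<And>i. i \<in> K \<Longrightarrow> (g i \<longlongrightarrow> g i x) (nhds x)"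
    "\<And>i. i \<in> K \<Longrightarrow> (D i \<longlongrightarrow> D i x) (nhds x)"
    using cont contg contD by (auto simp: continuous_on_eq_continuous_at isCont_def tendsto_at_iff_tendsto_nhds)
  have "\<forall>\<^sub>F z in nhds x. if i \<in> A then D i z \<bullet> v < M else g i z - f z \<noteq> 0" if "i \<in> K" for i
  proof (cases "i \<in> A")
    case True
    then show ?thesis
      using order_tendstoD(2)[OF tendsto_inner[OF lim(3)[OF that] tendsto_const], of v M] bound
      by (simp add: A_def)
  next
    case False
    then show ?thesis
      using tendsto_imp_eventually_ne[OF tendsto_diff[OF lim(2)[OF that] lim(1)], of 0] that
      by (simp add: A_def)
  qed
  then have "\<forall>\<^sub>F z in nhds x. \<forall>i\<in>K. if i \<in> A then D i z \<bullet> v < M else g i z - f z \<noteq> 0"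
    using \<open>finite K\<close> by (intro eventually_ball_finite) auto
  then obtain e where "e > 0" and e: "\<And>z i. dist z x < e \<Longrightarrow> i \<in> K \<Longrightarrow>
      if i \<in> A then D i z \<bullet> v < M else g i z - f z \<noteq> 0"
    unfolding eventually_nhds_metric by blast
  have "f (y + t *\<^sub>R v) - f y \<le> M * t" if y: "dist y x < e / 2" and t: "0 < t" "t * norm v < e / 2" for y t
  proof -
    have near: "dist (y + s *\<^sub>R v) x < e" if "s \<in> {0..t}" for s
    proof -
      have "dist (y + s *\<^sub>R v) x \<le> dist (y + s *\<^sub>R v) y + dist y x" by (rule dist_triangle)
      also have "dist (y + s *\<^sub>R v) y = s * norm v" using that by (simp add: dist_norm)
      also have "\<dots> \<le> t * norm v" using that by (intro mult_right_mono) auto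
      finally show ?thesis using y t by simp
    qed
    let ?h = "\<lambda>s. f (y + s *\<^sub>R v) - M * s"
    have "?h t \<le> ?h 0"
    proof (rule continuous_selection_nonincreasing[where h = ?h and K = A and g = "\<lambda>i s. g i (y + s *\<^sub>R v) - M * s"])
      show "continuous_on {0..t} ?h"
        by (intro continuous_intros continuous_on_compose2[OF cont]) auto
      show "finite A" using \<open>finite K\<close> by (simp add: A_def)
      show "\<exists>i\<in>A. ?h s = g i (y + s *\<^sub>R v) - M * s" if s: "s \<in> {0..t}" for s
      proof -
        obtain i where "i \<in> K" "f (y + s *\<^sub>R v) = g i (y + s *\<^sub>R v)" using sel by blast
        then show ?thesis using e[OF near[OF s], of i] by (auto split: if_splits)
      qed
      fix i p q assume i: "i \<in> A" and pq: "0 \<le> p" "p \<le> q" "q \<le> t"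
      show "g i (y + q *\<^sub>R v) - M * q \<le> g i (y + p *\<^sub>R v) - M * p"
      proof (rule DERIV_nonpos_imp_nonincreasing[OF pq(2)])
        fix s assume s: "p \<le> s" "s \<le> q"
        have "i \<in> K" using i by (simp add: A_def)
        have "((\<lambda>s. g i (y + s *\<^sub>R v) - M * s) has_field_derivative D i (y + s *\<^sub>R v) \<bullet> v - M) (at s)"
          by (auto intro!: derivative_eq_intros deriv[OF \<open>i \<in> K\<close>])
        moreover have "D i (y + s *\<^sub>R v) \<bullet> v - M \<le> 0"
          using e[OF near \<open>i \<in> K\<close>, of s] i s pq by simp
        ultimately show "\<exists>l. ((\<lambda>s. g i (y + s *\<^sub>R v) - M * s) has_field_derivative l) (at s) \<and> l \<le> 0"
          by blast
      qed
    qed (use t in simp)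
    then show ?thesis by simp
  qed
  then have quot: "(f (y + t *\<^sub>R v) - f y) / t \<le> M"
    if "dist y x < e / 2" "0 < t" "t * norm v < e / 2" for y t
    using that by (simp add: divide_le_eq)
  have "\<forall>\<^sub>F y in nhds x. dist y x < e / 2"
    using \<open>e > 0\<close> by (auto simp: eventually_nhds_metric intro!: exI[of _ "e / 2"])
  moreover have "\<forall>\<^sub>F t in at_right 0. 0 < t \<and> t * norm v < e / 2"
  proof -
    have "((\<lambda>t. t * norm v) \<longlongrightarrow> 0 * norm v) (at_right 0)"
      by (intro tendsto_intros)
    then show ?thesis
      using \<open>e > 0\<close>
      by (intro eventually_conj eventually_at_right_less order_tendstoD(2)[where y = "0 * norm v"]) auto
  qed
  ultimately have "\<forall>\<^sub>F z in nhds x \<times>\<^sub>F at_right 0.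
      (case z of (y, t) \<Rightarrow> ereal ((f (y + t *\<^sub>R v) - f y) / t)) \<le> ereal M"
    unfolding eventually_prod_filter using quot by fastforce
  then show ?thesis
    unfolding clarke_derivative_def by (rule Limsup_bounded)
qed

text \<open>If all active pieces increase along \<open>v\<close> at a rate above \<open>c\<close>,
  the Clarke derivative along \<open>- v\<close> is at most \<open>- c\<close>; hence every
  subgradient has inner product at least \<open>c\<close> with \<open>v\<close>.\<close>

lemma clarke_subdifferential_norm_ge:
  fixes f :: "'a::euclidean_space \<Rightarrow> real" and g :: "'i \<Rightarrow> 'a \<Rightarrow> real" and D :: "'i \<Rightarrow> 'a \<Rightarrow> 'a"
  assumes "finite K" "continuous_on UNIV f" "\<And>y. \<exists>i\<in>K. f y = g i y"
    and deriv: "\<And>i y t w. i \<in> K \<Longrightarrow>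
      ((\<lambda>t. g i (y + t *\<^sub>R w)) has_field_derivative D i (y + t *\<^sub>R w) \<bullet> w) (at t)"
    and "\<And>i. i \<in> K \<Longrightarrow> continuous_on UNIV (g i)"
    and "\<And>i. i \<in> K \<Longrightarrow> continuous_on UNIV (D i)"
    and bound: "\<And>i. i \<in> K \<Longrightarrow> g i x = f x \<Longrightarrow> c < D i x \<bullet> v"
    and \<zeta>: "\<zeta> \<in> clarke_subdifferential f x"
  shows "c \<le> norm \<zeta> * norm v"
proof -
  have "clarke_derivative f x (- v) \<le> ereal (- c)"
    using assms(1-3) deriv assms(5,6)
    by (rule clarke_derivative_le_active) (use bound in auto)
  moreover have "ereal (\<zeta> \<bullet> (- v)) \<le> clarke_derivative f x (- v)"
    using \<zeta> unfolding clarke_subdifferential_def by blast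
  ultimately have "ereal (\<zeta> \<bullet> (- v)) \<le> ereal (- c)" by (rule order_trans[rotated])
  then have "c \<le> \<zeta> \<bullet> v" by simp
  also have "\<dots> \<le> norm \<zeta> * norm v" by (rule norm_cauchy_schwarz)
  finally show ?thesis .
qed

section \<open>Behaviour at infinity\<close>

definition monomial :: "('n::finite \<Rightarrow> nat) \<Rightarrow> ('n \<Rightarrow> real) \<Rightarrow> real" where
  "monomial \<alpha> y = (\<Prod>j\<in>UNIV. y j ^ \<alpha> j)"

text \<open>For \<open>\<alpha> l = 0\<close> the truncated exponent \<open>\<alpha> l - 1\<close>
  is harmless, since the factor \<open>real (\<alpha> l)\<close> vanishes.\<close>

definition monomial_partial :: "('n::finite \<Rightarrow> nat) \<Rightarrow> 'n \<Rightarrow> ('n \<Rightarrow> real) \<Rightarrow> real" where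
  "monomial_partial \<alpha> l y = real (\<alpha> l) * y l ^ (\<alpha> l - 1) * (\<Prod>j\<in>UNIV - {l}. y j ^ \<alpha> j)"

text \<open>
  Homogenisation by an extra variable \<open>s\<close>: \<open>s = 1\<close> gives the polynomial itself and \<open>s = 0\<close> its part of
  degree exactly \<open>d\<close>, because \<open>0 ^ 0 = 1\<close>.
\<close>

definition homogenised ::
    "nat \<Rightarrow> (nat \<times> ('n::finite \<Rightarrow> nat) \<Rightarrow> real) \<Rightarrow> nat \<Rightarrow> ('n \<Rightarrow> real) \<Rightarrow> real \<Rightarrow> real" where
  "homogenised d u i y s = (\<Sum>\<alpha>\<in>multi_indices d. u (i, \<alpha>) * s ^ (d - sum \<alpha> UNIV) * monomial \<alpha> y)"

definition homogenised_partial ::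
    "nat \<Rightarrow> (nat \<times> ('n::finite \<Rightarrow> nat) \<Rightarrow> real) \<Rightarrow> nat \<Rightarrow> 'n \<Rightarrow> ('n \<Rightarrow> real) \<Rightarrow> real \<Rightarrow> real" where
  "homogenised_partial d u i l y s =
    (\<Sum>\<alpha>\<in>multi_indices d. u (i, \<alpha>) * s ^ (d - sum \<alpha> UNIV) * monomial_partial \<alpha> l y)"

definition homogenised_gradient ::
    "nat \<Rightarrow> (nat \<times> ('n::finite \<Rightarrow> nat) \<Rightarrow> real) \<Rightarrow> nat \<Rightarrow> real ^ 'n \<Rightarrow> real \<Rightarrow> real ^ 'n" where
  "homogenised_gradient d u i y s = (\<chi> l. homogenised_partial d u i l (($) y) s)"

section \<open>Scaling laws and Euler's identity\<close>

lemma monomial_scale: "monomial \<alpha> (\<lambda>j. c * y j) = c ^ sum \<alpha> UNIV * monomial \<alpha> y"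
  by (simp add: monomial_def power_mult_distrib prod.distrib power_sum)

text \<open>The factor \<open>c\<close> on the left avoids the exponent
  \<open>sum \<alpha> UNIV - 1\<close>, which natural subtraction would spoil for the zero
  multi-index.\<close>

lemma monomial_partial_scale:
  "c * monomial_partial \<alpha> l (\<lambda>j. c * y j) = c ^ sum \<alpha> UNIV * monomial_partial \<alpha> l y"
proof (cases "\<alpha> l")
  case 0
  then show ?thesis by (simp add: monomial_partial_def)
next
  case (Suc k)
  have "sum \<alpha> UNIV = \<alpha> l + sum \<alpha> (UNIV - {l})"
    by (rule sum.remove) auto
  then have "c ^ sum \<alpha> UNIV = c * c ^ k * (\<Prod>j\<in>UNIV - {l}. c ^ \<alpha> j)"
    by (simp add: Suc power_add power_sum)
  then show ?thesis
    by (simp add: monomial_partial_def Suc power_mult_distrib prod.distrib)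
qed

lemma monomial_euler: "(\<Sum>l\<in>UNIV. y l * monomial_partial \<alpha> l y) = real (sum \<alpha> UNIV) * monomial \<alpha> y"
proof -
  have "y l * monomial_partial \<alpha> l y = real (\<alpha> l) * monomial \<alpha> y" for l
  proof (cases "\<alpha> l")
    case 0
    then show ?thesis by (simp add: monomial_partial_def)
  next
    case (Suc k)
    have "monomial \<alpha> y = y l ^ \<alpha> l * (\<Prod>j\<in>UNIV - {l}. y j ^ \<alpha> j)"
      unfolding monomial_def by (rule prod.remove) auto
    then show ?thesis by (simp add: monomial_partial_def Suc)
  qed
  then show ?thesis by (simp add: sum_distrib_right)
qed

lemma homogenised_scale: "homogenised d u i (\<lambda>j. c * y j) (c * s) = c ^ d * homogenised d u i y s"
proof -
  have "u (i, \<alpha>) * (c * s) ^ (d - sum \<alpha> UNIV) * monomial \<alpha> (\<lambda>j. c * y j) =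
      c ^ d * (u (i, \<alpha>) * s ^ (d - sum \<alpha> UNIV) * monomial \<alpha> y)" if "\<alpha> \<in> multi_indices d" for \<alpha>
  proof -
    have "c ^ d = c ^ (d - sum \<alpha> UNIV) * c ^ sum \<alpha> UNIV"
      using that by (simp add: multi_indices_def flip: power_add)
    then show ?thesis by (simp add: monomial_scale power_mult_distrib)
  qed
  then show ?thesis unfolding homogenised_def sum_distrib_left by (rule sum.cong[OF refl])
qed

lemma homogenised_partial_scale:
  "c * homogenised_partial d u i l (\<lambda>j. c * y j) (c * s) = c ^ d * homogenised_partial d u i l y s"
proof -
  have "c * (u (i, \<alpha>) * (c * s) ^ (d - sum \<alpha> UNIV) * monomial_partial \<alpha> l (\<lambda>j. c * y j)) =
      c ^ d * (u (i, \<alpha>) * s ^ (d - sum \<alpha> UNIV) * monomial_partial \<alpha> l y)" if "\<alpha> \<in> multi_indices d" for \<alpha>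
  proof -
    have "c ^ d = c ^ (d - sum \<alpha> UNIV) * c ^ sum \<alpha> UNIV"
      using that by (simp add: multi_indices_def flip: power_add)
    moreover have "c * (u (i, \<alpha>) * (c * s) ^ (d - sum \<alpha> UNIV) * monomial_partial \<alpha> l (\<lambda>j. c * y j)) =
      u (i, \<alpha>) * (c * s) ^ (d - sum \<alpha> UNIV) * (c * monomial_partial \<alpha> l (\<lambda>j. c * y j))"
      by simp
    ultimately show ?thesis by (simp add: monomial_partial_scale power_mult_distrib)
  qed
  then show ?thesis unfolding homogenised_partial_def sum_distrib_left by (rule sum.cong[OF refl])
qed

lemma homogenised_gradient_scale:
  "c *\<^sub>R homogenised_gradient d u i (c *\<^sub>R y) (c * s) = c ^ d *\<^sub>R homogenised_gradient d u i y s"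
proof -
  have "($) (c *\<^sub>R y) = (\<lambda>j. c * y $ j)" by (simp add: fun_eq_iff)
  then show ?thesis
    using homogenised_partial_scale[of c d u i _ "($) y" s]
    by (simp add: vec_eq_iff homogenised_gradient_def)
qed

text \<open>At \<open>s = 0\<close> only monomials of degree exactly \<open>d\<close> survive, so
  all Euler factors equal \<open>d\<close>.\<close>

lemma homogenised_euler:
  "y \<bullet> homogenised_gradient d u i y 0 = real d * homogenised d u i (($) y) 0"
proof -
  have "y \<bullet> homogenised_gradient d u i y 0 =
      (\<Sum>\<alpha>\<in>multi_indices d. u (i, \<alpha>) * 0 ^ (d - sum \<alpha> UNIV) * (\<Sum>l\<in>UNIV. y $ l * monomial_partial \<alpha> l (($) y)))"
    unfolding inner_vec_def homogenised_gradient_def homogenised_partial_def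
    by (simp add: sum_distrib_left mult_ac sum.swap[of _ UNIV])
  also have "\<dots> = (\<Sum>\<alpha>\<in>multi_indices d. real d * (u (i, \<alpha>) * 0 ^ (d - sum \<alpha> UNIV) * monomial \<alpha> (($) y)))"
  proof (intro sum.cong refl)
    fix \<alpha> :: "'a \<Rightarrow> nat" assume "\<alpha> \<in> multi_indices d"
    then consider "sum \<alpha> UNIV = d" | "d - sum \<alpha> UNIV > 0"
      by (auto simp: multi_indices_def le_less)
    then show "u (i, \<alpha>) * 0 ^ (d - sum \<alpha> UNIV) * (\<Sum>l\<in>UNIV. y $ l * monomial_partial \<alpha> l (($) y)) =
        real d * (u (i, \<alpha>) * 0 ^ (d - sum \<alpha> UNIV) * monomial \<alpha> (($) y))"
      by cases (simp_all add: monomial_euler)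
  qed
  also have "\<dots> = real d * homogenised d u i (($) y) 0"
    by (simp add: homogenised_def sum_distrib_left)
  finally show ?thesis .
qed

lemma family_poly_eq_homogenised: "family_poly d u i x = homogenised d u i (($) x) 1"
  by (simp add: family_poly_def homogenised_def monomial_def)

lemma continuous_on_homogenised:
  "continuous_on UNIV (\<lambda>(y, s). homogenised d u i (($) y) s)"
  unfolding homogenised_def monomial_def case_prod_beta by (intro continuous_intros)

lemma continuous_on_homogenised_gradient:
  "continuous_on UNIV (\<lambda>(y, s). homogenised_gradient d u i y s)"
  unfolding homogenised_gradient_def homogenised_partial_def monomial_partial_def case_prod_beta
  by (intro continuous_intros continuous_on_vec_lambda)

lemma monomial_has_derivative_on_line:
  fixes y v :: "real ^ 'n"
  shows "((\<lambda>t. monomial \<alpha> (($) (y + t *\<^sub>R v))) has_field_derivative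
    (\<Sum>l\<in>UNIV. monomial_partial \<alpha> l (($) (y + t *\<^sub>R v)) * v $ l)) (at t)"
proof -
  have "((\<lambda>t. (y $ l + t * v $ l) ^ \<alpha> l) has_field_derivative
      real (\<alpha> l) * (y $ l + t * v $ l) ^ (\<alpha> l - 1) * v $ l) (at t)" for l
    by (auto intro!: derivative_eq_intros)
  from has_field_derivative_prod[of UNIV, OF this] show ?thesis
    by (simp add: monomial_def monomial_partial_def mult_ac)
qed

lemma family_poly_has_derivative_on_line:
  fixes y v :: "real ^ 'n"
  shows "((\<lambda>t. family_poly d u i (y + t *\<^sub>R v)) has_field_derivative
    homogenised_gradient d u i (y + t *\<^sub>R v) 1 \<bullet> v) (at t)"
proof -
  have "((\<lambda>t. \<Sum>\<alpha>\<in>multi_indices d. u (i, \<alpha>) * monomial \<alpha> (($) (y + t *\<^sub>R v))) has_field_derivative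
    (\<Sum>\<alpha>\<in>multi_indices d. u (i, \<alpha>) * (\<Sum>l\<in>UNIV. monomial_partial \<alpha> l (($) (y + t *\<^sub>R v)) * v $ l))) (at t)"
    by (intro DERIV_sum DERIV_cmult monomial_has_derivative_on_line)
  moreover have "(\<Sum>\<alpha>\<in>multi_indices d. u (i, \<alpha>) * (\<Sum>l\<in>UNIV. monomial_partial \<alpha> l (($) (y + t *\<^sub>R v)) * v $ l)) =
      homogenised_gradient d u i (y + t *\<^sub>R v) 1 \<bullet> v"
    unfolding inner_vec_def homogenised_gradient_def homogenised_partial_def
    by (simp add: sum_distrib_left sum_distrib_right mult_ac sum.swap[of _ UNIV])
  ultimately show ?thesis
    by (simp add: family_poly_eq_homogenised homogenised_def)
qed

text \<open>Directions in which no leading form vanishes satisfy this automatically, the convex hull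
  of the empty set being empty.\<close>

definition nondegenerate_at_infinity ::
    "nat \<Rightarrow> nat \<Rightarrow> (nat \<times> ('n::finite \<Rightarrow> nat) \<Rightarrow> real) \<Rightarrow> bool" where
  "nondegenerate_at_infinity r d u \<longleftrightarrow>
    (\<forall>y::real ^ 'n. y \<noteq> 0 \<longrightarrow> 0 \<notin> convex hull
      ((\<lambda>i. homogenised_gradient d u i y 0) ` {i \<in> {1..r}. homogenised d u i (($) y) 0 = 0}))"

text \<open>Here \<open>(y, s)\<close> are coordinates at infinity for the point
  \<open>y /\<^sub>R s\<close>. The homogenised gradient is the true one times
  \<open>s ^ (d - 1)\<close>, a factor in (0, 1], so a positive lower bound on a directional
  derivative passes to the true gradient.\<close>

lemma continuous_selection_subdifferential_norm_ge:
  fixes u :: "nat \<times> ('n::finite \<Rightarrow> nat) \<Rightarrow> real" and y :: "real ^ 'n"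
  assumes "f \<in> continuous_selections r d u" and s: "0 < s" "s \<le> 1" and "1 \<le> d" and "0 \<le> c"
    and bound: "\<And>i. i \<in> {1..r} \<Longrightarrow> homogenised d u i (($) y) s = s ^ d * f (y /\<^sub>R s) \<Longrightarrow>
      c < homogenised_gradient d u i y s \<bullet> v"
    and \<zeta>: "\<zeta> \<in> clarke_subdifferential f (y /\<^sub>R s)"
  shows "c \<le> norm \<zeta> * norm v"
proof (rule clarke_subdifferential_norm_ge[where K = "{1..r}" and g = "family_poly d u"
      and D = "\<lambda>i x. homogenised_gradient d u i x 1" and x = "y /\<^sub>R s"])
  show "continuous_on UNIV f" "\<And>x. \<exists>i\<in>{1..r}. f x = family_poly d u i x"
    using assms(1) by (auto simp: continuous_selections_def)
  show "((\<lambda>t. family_poly d u i (x + t *\<^sub>R w)) has_field_derivative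
      homogenised_gradient d u i (x + t *\<^sub>R w) 1 \<bullet> w) (at t)" for i x t w
    by (rule family_poly_has_derivative_on_line)
  show "continuous_on UNIV (family_poly d u i)" for i
    unfolding family_poly_eq_homogenised
    using continuous_on_compose2[OF continuous_on_homogenised[of d u i], of UNIV "\<lambda>x. (x, 1)"]
    by (simp add: continuous_intros)
  show "continuous_on UNIV (\<lambda>x. homogenised_gradient d u i x 1)" for i
    using continuous_on_compose2[OF continuous_on_homogenised_gradient[of d u i], of UNIV "\<lambda>x. (x, 1)"]
    by (simp add: continuous_intros)
  fix i assume i: "i \<in> {1..r}" "family_poly d u i (y /\<^sub>R s) = f (y /\<^sub>R s)"
  have "($) y = (\<lambda>j. s * (y /\<^sub>R s) $ j)" using s by (auto simp: fun_eq_iff)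
  then have "homogenised d u i (($) y) s = s ^ d * family_poly d u i (y /\<^sub>R s)"
    using homogenised_scale[of d u i s "($) (y /\<^sub>R s)" 1] by (simp add: family_poly_eq_homogenised)
  then have *: "c < homogenised_gradient d u i y s \<bullet> v" using i by (intro bound) simp_all
  have "s *\<^sub>R homogenised_gradient d u i y s = s ^ d *\<^sub>R homogenised_gradient d u i (y /\<^sub>R s) 1"
    using homogenised_gradient_scale[of s d u i "y /\<^sub>R s" 1] s by simp
  moreover have "s ^ d = s * s ^ (d - 1)" using \<open>1 \<le> d\<close> by (cases d) auto
  ultimately have grad: "homogenised_gradient d u i y s = s ^ (d - 1) *\<^sub>R homogenised_gradient d u i (y /\<^sub>R s) 1"
    using s by (simp flip: scaleR_scaleR)
  have "0 < s ^ (d - 1) * (homogenised_gradient d u i (y /\<^sub>R s) 1 \<bullet> v)"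
    using * \<open>0 \<le> c\<close> by (simp add: grad)
  then have "0 < homogenised_gradient d u i (y /\<^sub>R s) 1 \<bullet> v" using s by (simp add: zero_less_mult_iff)
  moreover have "s ^ (d - 1) \<le> 1" using s by (simp add: power_le_one)
  ultimately have "s ^ (d - 1) * (homogenised_gradient d u i (y /\<^sub>R s) 1 \<bullet> v) \<le> homogenised_gradient d u i (y /\<^sub>R s) 1 \<bullet> v"
    by (intro mult_left_le_one_le) (use s in auto)
  then show "c < homogenised_gradient d u i (y /\<^sub>R s) 1 \<bullet> v"
    using * by (simp add: grad)
qed (use \<zeta> in auto)

lemma continuous_on_UNIV_tendsto_nhds:
  fixes f :: "'a::t2_space \<Rightarrow> 'b::topological_space"
  shows "continuous_on UNIV f \<Longrightarrow> (f \<longlongrightarrow> f a) (nhds a)"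
  by (simp add: continuous_on_eq_continuous_at isCont_def tendsto_at_iff_tendsto_nhds)

text \<open>
  Either every active piece has a leading form vanishing at \<open>y\<^sub>0\<close>, and a vector separating their
  gradients from \<open>0\<close> is a direction of uniform increase; or the common value of the active pieces
  is of order \<open>\<bar>x\<bar> ^ d\<close>, and by Euler's identity the radial derivatives of all of them are large with the
  same sign.
\<close>

lemma subdifferential_norm_ge_near_direction:
  fixes u :: "nat \<times> ('n::finite \<Rightarrow> nat) \<Rightarrow> real" and y0 :: "real ^ 'n"
  assumes nd: "nondegenerate_at_infinity r d u" and f: "f \<in> continuous_selections r d u"
    and "1 \<le> d" and y0: "norm y0 = 1"
  shows "\<exists>c>0. \<forall>\<^sub>F (y, s) in nhds (y0, 0). norm y = 1 \<longrightarrow> 0 < s \<longrightarrow>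
    (\<forall>\<zeta>\<in>clarke_subdifferential f (y /\<^sub>R s). c \<le> norm \<zeta>)"
proof -
  let ?F = "\<lambda>i z. homogenised d u i (($) (fst z)) (snd z)"
  let ?G = "\<lambda>i z. homogenised_gradient d u i (fst z) (snd z)"
  define Z where "Z = {i \<in> {1..r}. homogenised d u i (($) y0) 0 = 0}"
  have limF: "(?F i \<longlongrightarrow> homogenised d u i (($) y0) 0) (nhds (y0, 0))" for i
    using continuous_on_UNIV_tendsto_nhds[OF continuous_on_homogenised, of d u i "(y0, 0)"]
    by (simp add: case_prod_unfold)
  have limG: "(?G i \<longlongrightarrow> homogenised_gradient d u i y0 0) (nhds (y0, 0))" for i
    using continuous_on_UNIV_tendsto_nhds[OF continuous_on_homogenised_gradient, of d u i "(y0, 0)"]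
    by (simp add: case_prod_unfold)
  have limfst: "(fst \<longlongrightarrow> y0) (nhds (y0, 0::real))" and limsnd: "(snd \<longlongrightarrow> 0) (nhds (y0, 0::real))"
    using continuous_on_UNIV_tendsto_nhds[of fst "(y0, 0::real)"]
      continuous_on_UNIV_tendsto_nhds[of snd "(y0, 0::real)"]
    by (simp_all add: continuous_on_fst continuous_on_snd continuous_on_id)
  have "y0 \<noteq> 0" using y0 by auto
  then have "0 \<notin> convex hull ((\<lambda>i. homogenised_gradient d u i y0 0) ` Z)"
    using nd by (simp add: nondegenerate_at_infinity_def Z_def)
  moreover have "closed (convex hull ((\<lambda>i. homogenised_gradient d u i y0 0) ` Z))"
    by (intro compact_imp_closed finite_imp_compact_convex_hull) (simp add: Z_def)
  ultimately obtain a b where "a \<noteq> 0" "0 < b"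
    and "\<forall>x\<in>convex hull ((\<lambda>i. homogenised_gradient d u i y0 0) ` Z). b < a \<bullet> x"
    using separating_hyperplane_closed_0[OF convex_convex_hull] by blast
  then have ab: "b < homogenised_gradient d u i y0 0 \<bullet> a" if "i \<in> Z" for i
    using hull_inc[OF imageI[OF that, of "\<lambda>i. homogenised_gradient d u i y0 0"], of convex]
    by (subst inner_commute) blast
  \<comment> \<open>Half of the least nonzero leading value leaves room for perturbation; the
    inserted 1 keeps the minimum defined when \<open>Z\<close> contains all indices.\<close>
  define \<beta> where "\<beta> = Min (insert 1 ((\<lambda>i. \<bar>homogenised d u i (($) y0) 0\<bar>) ` ({1..r} - Z))) / 2"
  have "\<beta> > 0" by (auto simp: \<beta>_def Z_def)
  have \<beta>: "\<beta> < \<bar>homogenised d u i (($) y0) 0\<bar>" if "i \<in> {1..r}" "i \<notin> Z" for i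
  proof -
    have "2 * \<beta> \<le> \<bar>homogenised d u i (($) y0) 0\<bar>"
      unfolding \<beta>_def using that by (auto intro!: Min_le)
    then show ?thesis using \<open>\<beta> > 0\<close> by linarith
  qed
  have "\<forall>\<^sub>F z in nhds (y0, 0). (if i \<in> Z then b < ?G i z \<bullet> a else \<beta> < \<bar>?F i z\<bar>) \<and>
      \<bar>fst z \<bullet> ?G i z - real d * ?F i z\<bar> < \<beta> / 2" if "i \<in> {1..r}" for i
  proof (rule eventually_conj)
    show "\<forall>\<^sub>F z in nhds (y0, 0). if i \<in> Z then b < ?G i z \<bullet> a else \<beta> < \<bar>?F i z\<bar>"
    proof (cases "i \<in> Z")
      case True
      then show ?thesis
        using order_tendstoD(1)[OF tendsto_inner[OF limG tendsto_const] ab] by simp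
    next
      case False
      then show ?thesis
        using order_tendstoD(1)[OF tendsto_rabs[OF limF] \<beta>] that by simp
    qed
    \<comment> \<open>The limit is 0 by Euler's identity, so near \<open>(y0, 0)\<close> the radial
      derivative is \<open>d\<close> times the value up to \<open>\<beta> / 2\<close>.\<close>
    have "((\<lambda>z. \<bar>fst z \<bullet> ?G i z - real d * ?F i z\<bar>) \<longlongrightarrow>
        \<bar>y0 \<bullet> homogenised_gradient d u i y0 0 - real d * homogenised d u i (($) y0) 0\<bar>) (nhds (y0, 0))"
      by (intro tendsto_intros limF limG limfst)
    from order_tendstoD(2)[OF this, of "\<beta> / 2"]
    show "\<forall>\<^sub>F z in nhds (y0, 0). \<bar>fst z \<bullet> ?G i z - real d * ?F i z\<bar> < \<beta> / 2"
      using \<open>\<beta> > 0\<close> by (simp add: homogenised_euler)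
  qed
  then have "\<forall>\<^sub>F z in nhds (y0, 0). \<forall>i\<in>{1..r}.
      (if i \<in> Z then b < ?G i z \<bullet> a else \<beta> < \<bar>?F i z\<bar>) \<and>
      \<bar>fst z \<bullet> ?G i z - real d * ?F i z\<bar> < \<beta> / 2"
    by (intro eventually_ball_finite) auto
  moreover have "\<forall>\<^sub>F z in nhds (y0, 0::real). snd z < 1"
    using order_tendstoD(2)[OF limsnd, of 1] by simp
  ultimately have ev: "\<forall>\<^sub>F z in nhds (y0, 0). snd z < 1 \<and> (\<forall>i\<in>{1..r}.
      (if i \<in> Z then b < ?G i z \<bullet> a else \<beta> < \<bar>?F i z\<bar>) \<and>
      \<bar>fst z \<bullet> ?G i z - real d * ?F i z\<bar> < \<beta> / 2)"
    by (rule eventually_conj[rotated])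
  \<comment> \<open>The two terms come from the test vectors \<open>a\<close> and
    \<open>sgn w *\<^sub>R y\<close>, the latter of norm 1.\<close>
  define c where "c = min (b / norm a) (\<beta> / 2)"
  have "c > 0" using \<open>a \<noteq> 0\<close> \<open>b > 0\<close> \<open>\<beta> > 0\<close> by (simp add: c_def)
  moreover have "\<forall>\<^sub>F (y, s) in nhds (y0, 0). norm y = 1 \<longrightarrow> 0 < s \<longrightarrow>
    (\<forall>\<zeta>\<in>clarke_subdifferential f (y /\<^sub>R s). c \<le> norm \<zeta>)"
  proof (rule eventually_mono[OF ev], safe)
    fix y s \<zeta>
    assume s1: "snd (y, s) < (1::real)" and y: "norm (y :: real ^ 'n) = 1" and s: "0 < s"
      and \<zeta>: "\<zeta> \<in> clarke_subdifferential f (y /\<^sub>R s)"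
    assume near: "\<forall>i\<in>{1..r}.
      (if i \<in> Z then b < ?G i (y, s) \<bullet> a else \<beta> < \<bar>?F i (y, s)\<bar>) \<and>
      \<bar>fst (y, s) \<bullet> ?G i (y, s) - real d * ?F i (y, s)\<bar> < \<beta> / 2"
    have s1: "s \<le> 1" using s1 by simp
    define w where "w = s ^ d * f (y /\<^sub>R s)"
    note norm_ge = continuous_selection_subdifferential_norm_ge[OF f s s1 \<open>1 \<le> d\<close> _ _ \<zeta>, folded w_def]
    show "c \<le> norm \<zeta>"
    proof (cases "\<exists>i\<in>{1..r}. i \<notin> Z \<and> homogenised d u i (($) y) s = w")
      case False
      have "b \<le> norm \<zeta> * norm a"
      proof (rule norm_ge)
        fix i assume i: "i \<in> {1..r}" "homogenised d u i (($) y) s = w"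
        then have "i \<in> Z" using False by blast
        then show "b < homogenised_gradient d u i y s \<bullet> a" using near[rule_format, OF i(1)] by simp
      qed (use \<open>0 < b\<close> in simp)
      then have "b / norm a \<le> norm \<zeta>" using \<open>a \<noteq> 0\<close> by (simp add: divide_le_eq)
      then show ?thesis by (simp add: c_def)
    next
      case True
      then obtain i where "i \<in> {1..r}" "i \<notin> Z" "homogenised d u i (($) y) s = w" by blast
      then have w: "\<beta> < \<bar>w\<bar>" using near[rule_format, of i] by simp
      \<comment> \<open>All active pieces, including those in \<open>Z\<close>, share the value
        \<open>w\<close>. Their derivatives along \<open>sgn w *\<^sub>R y\<close> therefore exceed
        \<open>d * \<bar>w\<bar> - \<beta> / 2\<close>, which is above
        \<open>\<beta> / 2\<close>.\<close>
      have "\<beta> / 2 \<le> norm \<zeta> * norm (sgn w *\<^sub>R y)"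
      proof (rule norm_ge)
        fix i assume i: "i \<in> {1..r}" "homogenised d u i (($) y) s = w"
        then have "\<bar>y \<bullet> homogenised_gradient d u i y s - real d * w\<bar> < \<beta> / 2"
          using near[rule_format, OF i(1)] by simp
        moreover have "\<bar>w\<bar> \<le> \<bar>real d * w\<bar>"
          using mult_right_mono[of 1 "real d" "\<bar>w\<bar>"] \<open>1 \<le> d\<close> by (simp add: abs_mult)
        moreover have "0 < w \<Longrightarrow> 0 \<le> real d * w" "w < 0 \<Longrightarrow> real d * w \<le> 0"
          by (simp_all add: mult_nonneg_nonpos)
        ultimately have "0 < w \<Longrightarrow> \<beta> / 2 < y \<bullet> homogenised_gradient d u i y s"
          "w < 0 \<Longrightarrow> \<beta> / 2 < - (y \<bullet> homogenised_gradient d u i y s)"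
          using w \<open>\<beta> > 0\<close> by linarith+
        then have "\<beta> / 2 < sgn w * (y \<bullet> homogenised_gradient d u i y s)"
          using w \<open>\<beta> > 0\<close> by (cases w "0 :: real" rule: linorder_cases) simp_all
        then show "\<beta> / 2 < homogenised_gradient d u i y s \<bullet> sgn w *\<^sub>R y"
          by (simp add: inner_commute)
      qed (use \<open>\<beta> > 0\<close> in simp)
      moreover have "w \<noteq> 0" using w \<open>\<beta> > 0\<close> by auto
      ultimately show ?thesis using y by (simp add: c_def)
    qed
  qed
  ultimately show ?thesis by blast
qed

text \<open>Otherwise there are ever smaller subgradients at points tending to infinity. A
  subsequence of the directions converges on the unit sphere, contradicting the uniform bound near
  the limit direction.\<close>

lemma nondegenerate_imp_good_at_infinity:
  fixes u :: "nat \<times> ('n::finite \<Rightarrow> nat) \<Rightarrow> real"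
  assumes nd: "nondegenerate_at_infinity r d u" and f: "f \<in> continuous_selections r d u"
    and "1 \<le> d"
  shows "good_at_infinity f"
proof (rule ccontr)
  assume *: "\<not> good_at_infinity f"
  have "\<exists>x \<zeta>. real m + 1 \<le> norm x \<and> \<zeta> \<in> clarke_subdifferential f x \<and> norm \<zeta> < 1 / (real m + 1)" for m
  proof -
    have "\<exists>x. real m + 1 \<le> norm x \<and> \<not> ereal (1 / (real m + 1)) \<le> nonsmooth_slope f x"
      using * unfolding good_at_infinity_def
      by (metis of_nat_0_le_iff zero_less_divide_1_iff add_nonneg_pos zero_less_one)
    then show ?thesis
      unfolding nonsmooth_slope_def by (auto simp: not_le INF_less_iff)
  qed
  then obtain x \<zeta> where x: "\<And>m. real m + 1 \<le> norm (x m)"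
    and \<zeta>: "\<And>m. \<zeta> m \<in> clarke_subdifferential f (x m)" "\<And>m. norm (\<zeta> m) < 1 / (real m + 1)"
    by metis
  have pos: "0 < norm (x m)" for m using x[of m] by linarith
  have "\<forall>m. x m /\<^sub>R norm (x m) \<in> sphere 0 1" using pos by simp
  then obtain y0 \<phi> where y0: "y0 \<in> sphere 0 1" and "strict_mono \<phi>"
    and y0_lim: "((\<lambda>m. x m /\<^sub>R norm (x m)) \<circ> \<phi>) \<longlonglongrightarrow> y0"
    using compact_sphere[of "0 :: real ^ 'n" 1] unfolding compact_def by meson
  have "(\<lambda>m. inverse (norm (x m))) \<longlonglongrightarrow> 0"
  proof (rule tendsto_sandwich[OF _ _ tendsto_const LIMSEQ_inverse_real_of_nat])
    show "\<forall>\<^sub>F m in sequentially. inverse (norm (x m)) \<le> inverse (real (Suc m))"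
      using x by (intro always_eventually allI le_imp_inverse_le) (auto simp: add.commute)
  qed simp
  then have s_lim: "((\<lambda>m. inverse (norm (x m))) \<circ> \<phi>) \<longlonglongrightarrow> 0"
    by (rule LIMSEQ_subseq_LIMSEQ[OF _ \<open>strict_mono \<phi>\<close>])
  obtain c where "c > 0" and c: "\<forall>\<^sub>F (y, s) in nhds (y0, 0). norm y = 1 \<longrightarrow> 0 < s \<longrightarrow>
    (\<forall>\<zeta>\<in>clarke_subdifferential f (y /\<^sub>R s). c \<le> norm \<zeta>)"
    using subdifferential_norm_ge_near_direction[OF nd f \<open>1 \<le> d\<close>, of y0] y0 by auto
  have "filterlim (\<lambda>m. (x (\<phi> m) /\<^sub>R norm (x (\<phi> m)), inverse (norm (x (\<phi> m))))) (nhds (y0, 0)) sequentially"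
    using tendsto_Pair[OF y0_lim s_lim] by (simp add: o_def)
  from filterlim_iff[THEN iffD1, OF this, rule_format, OF c]
  have "\<forall>\<^sub>F m in sequentially. c \<le> norm (\<zeta> (\<phi> m))"
  proof (rule eventually_mono)
    fix m
    have "x (\<phi> m) = (x (\<phi> m) /\<^sub>R norm (x (\<phi> m))) /\<^sub>R inverse (norm (x (\<phi> m)))"
      using pos[of "\<phi> m"] by simp
    then show "c \<le> norm (\<zeta> (\<phi> m))"
      if "case (x (\<phi> m) /\<^sub>R norm (x (\<phi> m)), inverse (norm (x (\<phi> m)))) of (y, s) \<Rightarrow>
        norm y = 1 \<longrightarrow> 0 < s \<longrightarrow> (\<forall>\<zeta>\<in>clarke_subdifferential f (y /\<^sub>R s). c \<le> norm \<zeta>)"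
      using that \<zeta>(1)[of "\<phi> m"] pos[of "\<phi> m"] by simp
  qed
  moreover have "\<forall>\<^sub>F m in sequentially. norm (\<zeta> (\<phi> m)) < c"
  proof -
    have "\<forall>\<^sub>F m in sequentially. inverse (real (Suc m)) < c"
      using LIMSEQ_inverse_real_of_nat \<open>c > 0\<close> by (rule order_tendstoD(2))
    then have "\<forall>\<^sub>F m in sequentially. norm (\<zeta> m) < c"
      by (rule eventually_mono) (use \<zeta>(2) in \<open>force simp: inverse_eq_divide add.commute intro: less_trans\<close>)
    then show ?thesis by (rule eventually_subseq[OF \<open>strict_mono \<phi>\<close>])
  qed
  ultimately have "\<forall>\<^sub>F m in sequentially. False"
    by eventually_elim simp
  then show False by simp
qed

section \<open>Degenerate systems\<close>

lemma homogenised_zero: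
  "homogenised d u i y 0 = (\<Sum>\<alpha>\<in>{\<alpha>. sum \<alpha> UNIV = d}. u (i, \<alpha>) * monomial \<alpha> y)"
  unfolding homogenised_def
  by (rule sum.mono_neutral_cong_right[OF finite_multi_indices]) (auto simp: multi_indices_def)

lemma homogenised_partial_zero:
  "homogenised_partial d u i l y 0 =
    (\<Sum>\<alpha>\<in>{\<alpha>. sum \<alpha> UNIV = d}. u (i, \<alpha>) * monomial_partial \<alpha> l y)"
  unfolding homogenised_partial_def
  by (rule sum.mono_neutral_cong_right[OF finite_multi_indices]) (auto simp: multi_indices_def)

lemma polynomial_in_monomial:
  "(\<And>j. polynomial_in I (\<lambda>w. y w j)) \<Longrightarrow> polynomial_in I (\<lambda>w. monomial \<alpha> (y w))"
  unfolding monomial_def by (intro polynomial_in_prod polynomial_in_power)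

lemma polynomial_in_monomial_partial:
  "(\<And>j. polynomial_in I (\<lambda>w. y w j)) \<Longrightarrow> polynomial_in I (\<lambda>w. monomial_partial \<alpha> l (y w))"
  unfolding monomial_partial_def
  by (intro polynomial_in_prod polynomial_in_power polynomial_in.mult polynomial_in.const)

text \<open>
  Normalise the degenerate direction by \<open>y\<^sub>j = 1\<close>. The equations \<open>p\<^sub>i(y) = 0\<close> for \<open>i \<in> J\<close> can be solved for
  the coefficients of \<open>x\<^sub>j ^ d\<close>, and the equations \<open>\<partial>\<^sub>l p\<^bsub>i0\<^esub>(y) = \<Sum>\<^sub>i \<mu>\<^sub>i \<partial>\<^sub>l p\<^sub>i(y)\<close> with
  \<open>l \<noteq> j\<close> for the coefficients of \<open>x\<^sub>l x\<^sub>j ^ (d - 1)\<close> in \<open>p\<^bsub>i0\<^esub>\<close>. Of the slots freed in this way, those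
  of \<open>x\<^sub>l x\<^sub>j ^ (d - 1)\<close> store \<open>y\<^sub>l\<close>, those of \<open>x\<^sub>j ^ d\<close> store \<open>\<mu>\<^sub>i\<close> for \<open>i \<noteq> i0\<close>, and the slot of
  \<open>x\<^sub>j ^ d\<close> in \<open>p\<^bsub>i0\<^esub>\<close> is left over, so the degenerate systems have one parameter fewer than all systems.
\<close>

lemma degenerate_systems_on_hypersurface:
  fixes j :: "'n::finite"
  assumes "1 \<le> d" "J \<subseteq> {1..r}" "i0 \<in> J"
  shows "\<exists>P. polynomial_in (coeff_indices r d) P \<and> (\<exists>u. P u \<noteq> 0) \<and>
    (\<forall>u y \<mu>. y j = 1 \<longrightarrow> (\<forall>i\<in>J. homogenised d u i y 0 = 0) \<longrightarrow>
      (\<forall>l. homogenised_partial d u i0 l y 0 =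
        (\<Sum>i\<in>J - {i0}. \<mu> i * homogenised_partial d u i l y 0)) \<longrightarrow> P u = 0)"
proof -
  define H where "H = {\<alpha> :: 'n \<Rightarrow> nat. sum \<alpha> UNIV = d}"
  define e where "e = (\<lambda>m. if m = j then d else 0)"
  \<comment> \<open>The exponent of \<open>x_l * x_j ^ (d - 1)\<close>. Since
    \<open>b j = e\<close>, only indices other than \<open>j\<close> are used below.\<close>
  define b where "b = (\<lambda>l m. (if m = j then d - 1 else 0) + (if m = l then 1 else 0 :: nat))"
  define B where "B = b ` (- {j})"
  define R where "R = H - {e} - B"
  let ?I = "coeff_indices r d :: (nat \<times> ('n \<Rightarrow> nat)) set"
  let ?I' = "?I - {(i0, e)}"

  have "H \<subseteq> multi_indices d" by (auto simp: H_def multi_indices_def)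
  then have finH: "finite H" using finite_multi_indices finite_subset by blast
  have finI: "finite ?I" by (simp add: coeff_indices_def finite_multi_indices)
  have "sum e UNIV = d" by (simp add: e_def)
  then have eH: "e \<in> H" by (simp add: H_def)
  have "sum (b l) UNIV = d" for l
    using \<open>1 \<le> d\<close> by (simp add: b_def sum.distrib)
  then have bH: "b l \<in> H" for l by (simp add: H_def)
  have b_diag: "b l l = 1" if "l \<noteq> j" for l
    using that by (simp add: b_def)
  have b_off: "b m l = 0" if "l \<noteq> j" "m \<noteq> l" for l m
    using that by (simp add: b_def)
  have b_neq: "b l \<noteq> e" if "l \<noteq> j" for l
    using that by (auto simp: b_def e_def fun_eq_iff intro!: exI[of _ l])
  have inj: "inj_on b (- {j})"
    by (rule inj_onI) (metis ComplD b_diag b_off insertI1 zero_neq_one)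
  have remove: "sum g H = g e + sum g (H - {e})" for g :: "('n \<Rightarrow> nat) \<Rightarrow> real"
    using finH eH by (rule sum.remove)
  have split: "sum g H = g e + sum g R + (\<Sum>l\<in>- {j}. g (b l))" for g :: "('n \<Rightarrow> nat) \<Rightarrow> real"
  proof -
    note remove
    also have "sum g (H - {e}) = sum g R + sum g B"
      unfolding R_def by (rule sum.subset_diff) (use finH bH b_neq in \<open>auto simp: B_def\<close>)
    also have "sum g B = (\<Sum>l\<in>- {j}. g (b l))"
      unfolding B_def by (simp add: sum.reindex[OF inj])
    finally show ?thesis by simp
  qed
  have memI: "(i, \<alpha>) \<in> ?I" if "i \<in> J" "\<alpha> \<in> H" for i \<alpha>
    using that assms(2) by (auto simp: coeff_indices_def H_def multi_indices_def)

  define Y where "Y = (\<lambda>w l. if l = j then 1 else w (i0, b l) :: real)"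
  \<comment> \<open>The value that the equation for the \<open>l\<close>-th partial forces on the
    coefficient of \<open>b l\<close> in piece \<open>i0\<close>. For \<open>l \<noteq> j\<close>
    the monomial \<open>e\<close> contributes nothing to these partials, so its slots are free to
    hold multipliers.\<close>
  define mix where "mix = (\<lambda>w l.
    (\<Sum>i\<in>J - {i0}. w (i, e) * (\<Sum>\<alpha>\<in>H - {e}. w (i, \<alpha>) * monomial_partial \<alpha> l (Y w))) -
    (\<Sum>\<alpha>\<in>R. w (i0, \<alpha>) * monomial_partial \<alpha> l (Y w)))"
  define \<phi> where "\<phi> = (\<lambda>(i, \<alpha>) w.
    if \<alpha> = e \<and> i = i0 then
      - (\<Sum>\<alpha>\<in>R. w (i0, \<alpha>) * monomial \<alpha> (Y w)) - (\<Sum>l\<in>- {j}. mix w l * monomial (b l) (Y w))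
    else if \<alpha> = e \<and> i \<in> J then - (\<Sum>\<alpha>\<in>H - {e}. w (i, \<alpha>) * monomial \<alpha> (Y w))
    else if i = i0 \<and> \<alpha> \<in> B then mix w (inv_into (- {j}) b \<alpha>)
    else w (i, \<alpha>))"

  \<comment> \<open>No component of \<open>\<phi>\<close> reads the slot \<open>(i0, e)\<close>;
    this is the saved parameter.\<close>
  have poly_coord: "polynomial_in ?I' (\<lambda>w. w (i, \<alpha>))" if "i \<in> J" "\<alpha> \<in> H" "i \<noteq> i0 \<or> \<alpha> \<noteq> e" for i \<alpha>
    using memI[OF that(1,2)] that(3) by (intro polynomial_in.coord) auto
  have poly_Y: "polynomial_in ?I' (\<lambda>w. Y w l)" for l
    using poly_coord[OF assms(3) bH] b_neq by (cases "l = j") (simp_all add: Y_def polynomial_in.const)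
  note poly_intros = polynomial_in_sum polynomial_in_diff polynomial_in_minus polynomial_in.mult
    polynomial_in_monomial polynomial_in_monomial_partial poly_Y poly_coord
  have poly_mix: "polynomial_in ?I' (\<lambda>w. mix w l)" for l
    unfolding mix_def by (intro poly_intros) (use assms(3) eH in \<open>auto simp: R_def\<close>)
  have poly_\<phi>: "polynomial_in ?I' (\<phi> k)" if "k \<in> ?I" for k
  proof -
    obtain i \<alpha> where k: "k = (i, \<alpha>)" by (cases k)
    consider "\<alpha> = e" "i = i0" | "\<alpha> = e" "i \<noteq> i0" "i \<in> J" | "i = i0" "\<alpha> \<in> B" "\<alpha> \<noteq> e"
      | "\<not> (i = i0 \<and> \<alpha> \<in> B)" "\<not> (\<alpha> = e \<and> i \<in> J)" "(i, \<alpha>) \<noteq> (i0, e)" using assms(3) by blast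
    then show ?thesis
    proof cases
      case 1
      have "polynomial_in ?I' (\<lambda>w. - (\<Sum>\<alpha>\<in>R. w (i0, \<alpha>) * monomial \<alpha> (Y w)) - (\<Sum>l\<in>- {j}. mix w l * monomial (b l) (Y w)))"
        by (intro poly_intros poly_mix) (use assms(3) in \<open>auto simp: R_def\<close>)
      then show ?thesis using 1 by (simp add: k \<phi>_def)
    next
      case 2
      have "polynomial_in ?I' (\<lambda>w. - (\<Sum>\<alpha>\<in>H - {e}. w (i, \<alpha>) * monomial \<alpha> (Y w)))"
        by (intro poly_intros) (use 2 in auto)
      then show ?thesis using 2 by (simp add: k \<phi>_def)
    next
      case 3
      then show ?thesis using poly_mix by (simp add: k \<phi>_def)
    next
      case 4
      have "polynomial_in ?I' (\<lambda>w. w (i, \<alpha>))"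
        using 4(3) that by (intro polynomial_in.coord) (auto simp: k)
      moreover have "\<phi> k = (\<lambda>w. w (i, \<alpha>))" using 4 by (auto simp: k \<phi>_def fun_eq_iff)
      ultimately show ?thesis by simp
    qed
  qed
  have "card ?I' < card ?I"
    using finI memI[OF assms(3) eH] by (intro psubset_card_mono) auto
  then have "\<exists>P. polynomial_in ?I P \<and> (\<exists>u. P u \<noteq> 0) \<and> (\<forall>w. P (\<lambda>k. \<phi> k w) = 0)"
    using finI poly_\<phi> by (intro polynomial_vanishing_on_image[of ?I ?I']) blast+
  then obtain P where P: "polynomial_in ?I P" "\<exists>u. P u \<noteq> 0" "\<And>w. P (\<lambda>k. \<phi> k w) = 0" by blast

  have "P u = 0"
    if y: "y j = 1" and zero: "\<And>i. i \<in> J \<Longrightarrow> homogenised d u i y 0 = 0"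
      and crit: "\<And>l. homogenised_partial d u i0 l y 0 = (\<Sum>i\<in>J - {i0}. \<mu> i * homogenised_partial d u i l y 0)"
    for u y \<mu>
  proof -
    \<comment> \<open>The inverse packing: \<open>y\<close> and \<open>\<mu>\<close> go into the
      freed slots, and all other coefficients are those of \<open>u\<close>.\<close>
    define w where "w = (\<lambda>(i, \<alpha>).
      if i = i0 \<and> \<alpha> \<in> B then y (inv_into (- {j}) b \<alpha>)
      else if i \<in> J - {i0} \<and> \<alpha> = e then \<mu> i else u (i, \<alpha>))"
    have inv: "inv_into (- {j}) b (b l) = l" if "l \<noteq> j" for l
      using inj that by (simp add: inv_into_f_f)
    have B: "b l \<in> B" if "l \<noteq> j" for l using that by (simp add: B_def)
    have Yw: "Y w = y"
      using y B inv by (auto simp: Y_def w_def fun_eq_iff)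
    have w_i0: "w (i0, \<alpha>) = u (i0, \<alpha>)" if "\<alpha> \<in> R" for \<alpha>
      using that by (simp add: w_def R_def)
    have w_J: "w (i, \<alpha>) = u (i, \<alpha>)" if "i \<in> J - {i0}" "\<alpha> \<in> H - {e}" for i \<alpha>
      using that by (simp add: w_def)
    have w_e: "w (i, e) = \<mu> i" if "i \<in> J - {i0}" for i
      using that by (simp add: w_def)
    have mono_e: "monomial e y = 1"
      using y by (auto simp: monomial_def e_def intro!: prod.neutral)
    have partial_e: "monomial_partial e l y = 0" if "l \<noteq> j" for l
      using that by (simp add: monomial_partial_def e_def)
    \<comment> \<open>At \<open>y j = 1\<close> the system for the coefficients of the
      \<open>b m\<close> has the identity matrix, so solving it needs no division and
      \<open>\<phi>\<close> stays polynomial.\<close>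
    have partial_b: "monomial_partial (b m) l y = (if m = l then 1 else 0)" if "l \<noteq> j" for m l
    proof (cases "m = l")
      case True
      have "(\<Prod>i\<in>UNIV - {l}. y i ^ b l i) = 1"
        using y by (intro prod.neutral) (simp add: b_def)
      then show ?thesis using True b_diag[OF that] by (simp add: monomial_partial_def)
    next
      case False
      then show ?thesis using b_off[OF that False] by (simp add: monomial_partial_def)
    qed
    have mix: "mix w l = u (i0, b l)" if l: "l \<noteq> j" for l
    proof -
      have "homogenised_partial d u i l y 0 = (\<Sum>\<alpha>\<in>H - {e}. w (i, \<alpha>) * monomial_partial \<alpha> l y)"
        if "i \<in> J - {i0}" for i
      proof -
        have "homogenised_partial d u i l y 0 = (\<Sum>\<alpha>\<in>H - {e}. u (i, \<alpha>) * monomial_partial \<alpha> l y)"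
          unfolding homogenised_partial_zero H_def[symmetric] remove
          by (simp add: partial_e[OF l])
        also have "\<dots> = (\<Sum>\<alpha>\<in>H - {e}. w (i, \<alpha>) * monomial_partial \<alpha> l y)"
          using w_J[OF that] by (intro sum.cong) simp_all
        finally show ?thesis .
      qed
      then have "(\<Sum>i\<in>J - {i0}. w (i, e) * (\<Sum>\<alpha>\<in>H - {e}. w (i, \<alpha>) * monomial_partial \<alpha> l y)) =
          homogenised_partial d u i0 l y 0"
        unfolding crit by (simp add: w_e)
      also have "\<dots> = (\<Sum>\<alpha>\<in>R. u (i0, \<alpha>) * monomial_partial \<alpha> l y) + u (i0, b l)"
        unfolding homogenised_partial_zero H_def[symmetric] split
        using l by (simp add: partial_e[OF l] partial_b[OF l] if_distrib cong: if_cong)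
      finally show ?thesis
        by (simp add: mix_def Yw w_i0)
    qed
    \<comment> \<open>Equality at every index, also outside \<open>?I\<close>, identifies the
      argument of \<open>P\<close> with \<open>u\<close> itself.\<close>
    have "\<phi> k w = u k" for k
    proof -
      obtain i \<alpha> where k: "k = (i, \<alpha>)" by (cases k)
      consider "\<alpha> = e" "i = i0" | "\<alpha> = e" "i \<noteq> i0" "i \<in> J" | "i = i0" "\<alpha> \<in> B" "\<alpha> \<noteq> e"
        | "\<not> (i = i0 \<and> \<alpha> \<in> B)" "\<not> (\<alpha> = e \<and> i \<in> J)" using assms(3) by blast
      then show ?thesis
      proof cases
        case 1
        have "0 = u (i0, e) + (\<Sum>\<alpha>\<in>R. u (i0, \<alpha>) * monomial \<alpha> y) + (\<Sum>l\<in>- {j}. u (i0, b l) * monomial (b l) y)"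
          using zero[OF assms(3)] unfolding homogenised_zero H_def[symmetric] split by (simp add: mono_e)
        moreover have "\<phi> k w = - (\<Sum>\<alpha>\<in>R. u (i0, \<alpha>) * monomial \<alpha> y) - (\<Sum>l\<in>- {j}. u (i0, b l) * monomial (b l) y)"
          using 1 by (simp add: k \<phi>_def Yw w_i0 mix)
        ultimately show ?thesis using 1 by (simp add: k)
      next
        case 2
        have "0 = u (i, e) + (\<Sum>\<alpha>\<in>H - {e}. u (i, \<alpha>) * monomial \<alpha> y)"
          using zero[OF 2(3)] unfolding homogenised_zero H_def[symmetric] remove by (simp add: mono_e)
        moreover have "\<phi> k w = - (\<Sum>\<alpha>\<in>H - {e}. u (i, \<alpha>) * monomial \<alpha> y)"
          using 2 w_J[of i] by (simp add: k \<phi>_def Yw)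
        ultimately show ?thesis using 2 by (simp add: k)
      next
        case 3
        then obtain l where "l \<noteq> j" "\<alpha> = b l" by (auto simp: B_def)
        then show ?thesis using 3 mix inv by (simp add: k \<phi>_def)
      next
        case 4
        then show ?thesis using assms(3) by (auto simp: k \<phi>_def w_def)
      qed
    qed
    then show ?thesis using P(3)[of w] by simp
  qed
  then show ?thesis using P(1,2) by blast
qed

text \<open>A coefficient of the convex combination is nonzero, and dividing by it expresses the
  partials of that piece through the others. Homogeneity then rescales the direction to have a
  coordinate equal to 1.\<close>

lemma degenerate_imp_critical:
  fixes u :: "nat \<times> ('n::finite \<Rightarrow> nat) \<Rightarrow> real"
  assumes "\<not> nondegenerate_at_infinity r d u"
  shows "\<exists>J\<subseteq>{1..r}. \<exists>i0\<in>J. \<exists>j y \<mu>. y j = 1 \<and> (\<forall>i\<in>J. homogenised d u i y 0 = 0) \<and>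
    (\<forall>l. homogenised_partial d u i0 l y 0 = (\<Sum>i\<in>J - {i0}. \<mu> i * homogenised_partial d u i l y 0))"
proof -
  obtain z :: "real ^ 'n" where "z \<noteq> 0" and hull: "0 \<in> convex hull
      ((\<lambda>i. homogenised_gradient d u i z 0) ` {i \<in> {1..r}. homogenised d u i (($) z) 0 = 0})"
    using assms by (auto simp: nondegenerate_at_infinity_def)
  let ?g = "\<lambda>i. homogenised_gradient d u i z 0"
  let ?Z = "{i \<in> {1..r}. homogenised d u i (($) z) 0 = 0}"
  \<comment> \<open>One index per distinct gradient, so that sums over the set of gradients become
    sums over \<open>J\<close>.\<close>
  have "\<exists>J\<subseteq>?Z. inj_on ?g J \<and> ?g ` ?Z = ?g ` J"
    using subset_image_inj[of "?g ` ?Z" ?g ?Z] by blast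
  then obtain J where J: "J \<subseteq> ?Z" and inj: "inj_on ?g J" and img: "?g ` ?Z = ?g ` J"
    by blast
  have "finite J" by (rule finite_subset[OF J]) simp
  have "0 \<in> convex hull (?g ` J)" using hull img by simp
  then obtain c where "sum c (?g ` J) = 1" "(\<Sum>x\<in>?g ` J. c x *\<^sub>R x) = 0"
    using \<open>finite J\<close> by (auto simp: convex_hull_finite)
  then have c: "(\<Sum>i\<in>J. c (?g i)) = 1" "(\<Sum>i\<in>J. c (?g i) *\<^sub>R ?g i) = 0"
    by (simp_all add: sum.reindex[OF inj])
  from c(1) obtain i0 where i0: "i0 \<in> J" "c (?g i0) \<noteq> 0"
    using sum.neutral[of J "\<lambda>i. c (?g i)"] by fastforce
  obtain j where j: "z $ j \<noteq> 0" using \<open>z \<noteq> 0\<close> by (auto simp: vec_eq_iff)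
  \<comment> \<open>\<open>q\<close> may be negative: the scaling laws hold for every real
    factor.\<close>
  define q where "q = 1 / z $ j"
  define y where "y = (\<lambda>m. q * z $ m)"
  have "y j = 1" using j by (simp add: y_def q_def)
  moreover have "\<forall>i\<in>J. homogenised d u i y 0 = 0"
    using J homogenised_scale[of d u _ q "($) z" 0] by (auto simp: y_def)
  moreover have "homogenised_partial d u i0 l y 0 =
      (\<Sum>i\<in>J - {i0}. (- c (?g i) / c (?g i0)) * homogenised_partial d u i l y 0)" for l
  proof -
    have "q * (\<Sum>i\<in>J. c (?g i) * homogenised_partial d u i l y 0) =
        (\<Sum>i\<in>J. c (?g i) * (q * homogenised_partial d u i l y 0))"
      by (simp add: sum_distrib_left mult_ac)
    also have "\<dots> = q ^ d * (\<Sum>i\<in>J. c (?g i) * homogenised_partial d u i l (($) z) 0)"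
      using homogenised_partial_scale[of q d u _ l "($) z" 0]
      by (simp add: y_def sum_distrib_left mult_ac)
    also have "(\<Sum>i\<in>J. c (?g i) * homogenised_partial d u i l (($) z) 0) = (\<Sum>i\<in>J. c (?g i) *\<^sub>R ?g i) $ l"
      by (simp add: homogenised_gradient_def)
    also have "\<dots> = 0" by (simp only: c(2) zero_index)
    finally have "(\<Sum>i\<in>J. c (?g i) * homogenised_partial d u i l y 0) = 0"
      using j by (simp add: q_def)
    then have "c (?g i0) * homogenised_partial d u i0 l y 0 =
        - (\<Sum>i\<in>J - {i0}. c (?g i) * homogenised_partial d u i l y 0)"
      using sum.remove[OF \<open>finite J\<close> i0(1), of "\<lambda>i. c (?g i) * homogenised_partial d u i l y 0"]
      by linarith
    then have "homogenised_partial d u i0 l y 0 =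
        - (\<Sum>i\<in>J - {i0}. c (?g i) * homogenised_partial d u i l y 0) / c (?g i0)"
      using i0(2) by (simp add: field_simps)
    then show ?thesis by (simp add: sum_divide_distrib sum_negf)
  qed
  ultimately show ?thesis
    using J i0(1) by (intro exI[of _ J] conjI bexI[of _ i0] exI[of _ j] exI[of _ y]
        exI[of _ "\<lambda>i. - c (?g i) / c (?g i0)"]) auto
qed

theorem theorem4p3:
  fixes d r :: nat
  assumes "1 \<le> d" and "1 \<le> r"
  shows "\<exists>U :: (nat \<times> ('n::finite \<Rightarrow> nat) \<Rightarrow> real) set.
    openin (powertop_real (coeff_indices r d)) U \<and>
    powertop_real (coeff_indices r d) closure_of U = topspace (powertop_real (coeff_indices r d)) \<and>
    semialgebraic_in (coeff_indices r d) U \<and>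
    (\<forall>u\<in>U. \<forall>f\<in>continuous_selections r d u. good_at_infinity f)"
proof -
  let ?I = "coeff_indices r d :: (nat \<times> ('n \<Rightarrow> nat)) set"
  \<comment> \<open>The finitely many families: the pieces \<open>J\<close> in the relation, the
    piece \<open>i0\<close> solved for, and the coordinate \<open>j\<close> normalised to 1.\<close>
  define T where "T = (SIGMA J:Pow {1..r}. J \<times> (UNIV :: 'n set))"
  have "finite T"
    unfolding T_def by (intro finite_SigmaI finite_cartesian_product) (auto intro: finite_subset)
  have "\<forall>t\<in>T. \<exists>P. polynomial_in ?I P \<and> (\<exists>u. P u \<noteq> 0) \<and>
    (\<forall>u y \<mu>. y (snd (snd t)) = 1 \<longrightarrow> (\<forall>i\<in>fst t. homogenised d u i y 0 = 0) \<longrightarrow>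
      (\<forall>l. homogenised_partial d u (fst (snd t)) l y 0 =
        (\<Sum>i\<in>fst t - {fst (snd t)}. \<mu> i * homogenised_partial d u i l y 0)) \<longrightarrow> P u = 0)"
    using degenerate_systems_on_hypersurface[OF assms(1)] by (auto simp: T_def)
  from bchoice[OF this] obtain P where P: "\<And>t. t \<in> T \<Longrightarrow> polynomial_in ?I (P t)"
    "\<And>t. t \<in> T \<Longrightarrow> \<exists>u. P t u \<noteq> 0"
    and P_zero: "\<And>t u y \<mu>. t \<in> T \<Longrightarrow> y (snd (snd t)) = 1 \<Longrightarrow> \<forall>i\<in>fst t. homogenised d u i y 0 = 0 \<Longrightarrow>
      \<forall>l. homogenised_partial d u (fst (snd t)) l y 0 =
        (\<Sum>i\<in>fst t - {fst (snd t)}. \<mu> i * homogenised_partial d u i l y 0) \<Longrightarrow> P t u = 0"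
    by blast
  \<comment> \<open>The product merges the hypersurfaces into one; it is a nonzero polynomial
    because each factor is.\<close>
  define Q where "Q = (\<lambda>u. \<Prod>t\<in>T. P t u)"
  have Q: "polynomial_in ?I Q" unfolding Q_def by (intro polynomial_in_prod P(1))
  have "\<exists>w. (\<Prod>t\<in>T. P t w) \<noteq> 0"
    using \<open>finite T\<close> P by (rule polynomial_in_prod_nonzero)
  then obtain w where w: "Q w \<noteq> 0" by (auto simp only: Q_def)
  have "good_at_infinity f" if "Q u \<noteq> 0" "f \<in> continuous_selections r d u" for u f
  proof (rule nondegenerate_imp_good_at_infinity[OF _ that(2) assms(1)], rule ccontr)
    assume "\<not> nondegenerate_at_infinity r d u"
    from degenerate_imp_critical[OF this] obtain J i0 j y \<mu> where J: "J \<subseteq> {1..r}" "i0 \<in> J"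
      and crit: "y j = 1" "\<forall>i\<in>J. homogenised d u i y 0 = 0"
        "\<forall>l. homogenised_partial d u i0 l y 0 = (\<Sum>i\<in>J - {i0}. \<mu> i * homogenised_partial d u i l y 0)"
      by blast
    have t: "(J, i0, j) \<in> T" using J by (simp add: T_def)
    have "P (J, i0, j) u = 0"
      using P_zero[OF t, of y u \<mu>] crit by simp
    then have "Q u = 0"
      unfolding Q_def using \<open>finite T\<close> t by (intro prod_zero) blast+
    then show False using that(1) by simp
  qed
  then show ?thesis
    using openin_polynomial_nonzero[OF Q] dense_polynomial_nonzero[where f = Q, OF Q w]
      semialgebraic_in_polynomial_nonzero[OF Q]
    by (intro exI[of _ "{u \<in> ?I \<rightarrow>\<^sub>E UNIV. Q u \<noteq> 0}"] conjI) blast+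
qed

end
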